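(* Let $\mathfrak{g}$ be a Kac--Moody algebra over $\mathbb{C}$ with simple roots indexed by $I$, let $J\subset I$, let $S$ be a convex set admitting a convex embedding into a finite-dimensional real vector space, with face poset $\mathcal{F}$, and let $\mathcal{P}\to S$ be an $S$ family of Weyl polyhedra for $J$. Let $J',J''\subset I$, with associated standard Levi subalgebras $\mathfrak{l}',\mathfrak{l}''$, and let $F',F''\in\mathcal{F}$. Let $J'_{\min}$ and $J'_{\max}$ be computed with respect to $\lambda(s)$ for $s$ in the relative interior of $F'$. Then: 1. $\operatorname{wt}_{\mathfrak{l}',F'}\subset\operatorname{wt}_{\mathfrak{l}'',F''}$ if and only if (i) $F'\subset F''$ and (ii) $J'_{\min}\subset J''$. 2. $\operatorname{wt}_{\mathfrak{l}',F'}=\operatorname{wt}_{\mathfrak{l}'',F''}$ if and only if (i) $F'=F''$ and (ii) $J'_{\min}\subset J''\subset J'_{\max}$. 3. For $w\in W_J$, $w\operatorname{wt}_{\mathfrak{l}',F'}\subset\operatorname{wt}_{\mathfrak{l}'',F''}$ if and only if (i) $F'\subset F''$ and (ii) for an interior point $s$ of $F'$, $w\operatorname{wt}_{\mathfrak{l}'}P(\lambda(s),J)\subset\operatorname{wt}_{\mathfrak{l}''}P(\lambda(s),J)$. 4. The stabilizer of $\operatorname{wt}_{\mathfrak{l}',F'}$ in $W_J$ is $W_{J'_{\max}\cap J}$.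
   Context: $\mathfrak{g}$ is the Kac--Moody algebra of a generalized Cartan matrix $(a_{ij})_{i,j\in I}$ ($I$ finite) with realization $(\mathfrak{h},\{\alpha_i\},\{\check\alpha_i\})$; $W$ is the Weyl group acting on $\mathfrak{h}^*$ and $W_K=\langle s_k:k\in K\rangle$. Standard Levi subalgebras $\mathfrak{l}_K$ correspond to subsets $K\subset I$ (generated by the Cartan $\mathfrak{h}$ and $e_k,f_k$, $k\in K$). Convexity in $\mathfrak{h}^*$ is with respect to its underlying real vector space. $D_J=\{\mu\in\mathfrak{h}^*:(\check\alpha_j,\mu)\in\mathbb{R}_{\ge0}\ \forall j\in J\}$. For $\lambda\in D_J$, $$P(\lambda,J)=\operatorname{conv}\bigcup_{w\in W_J,\ i\in I\setminus J}w(\lambda-\mathbb{R}_{\ge0}\alpha_i)$$ (meaning $\operatorname{conv}(W\lambda)$ if $J=I$). Weyl polyhedra for $J$ (finite convex combinations $\sum_it_i\operatorname{conv}V_i$, $t_i>0$, $\sum t_i=1$, of convex hulls of weights of highest weight modules $V_i$ for which $\{i\in I:f_i\text{ acts locally nilpotently on }V_i\}$ equals $J$) are exactly the sets $P(\lambda,J)$, $\lambda\in D_J$, and $P(\lambda,J)$ determines $\lambda$. An $S$ family of Weyl polyhedra is a subset $\mathcal{P}\subset S\times\mathfrak{h}^*$ whose fibers $F_s\subset\mathfrak{h}^*$ over $s\in S$ are all Weyl polyhedra and satisfy $tF_{s_0}+(1-t)F_{s_1}=F_{ts_0+(1-t)s_1}$ for $s_0,s_1\in S$, $0\le t\le1$.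 Write $F_s=P(\lambda(s),J)$, $\lambda(s)\in D_J$. $W_J$ acts on $\mathcal{P}$ through the second factor. For $K\subset I$ with Levi $\mathfrak{l}=\mathfrak{l}_K$, $\operatorname{wt}_{\mathfrak{l}}P(\lambda,J)$ denotes the exposed face of $P(\lambda,J)$ on which the functional $\sum_{i\in I\setminus K}\check\omega_i$ is maximal, where $\check\omega_i$ are elements of the real dual of $\mathfrak{h}^*$ with $(\check\omega_i,\alpha_j)=\delta_{ij}$. For a face $F$ of $S$, $\operatorname{wt}_{\mathfrak{l},F}:=\{(s,x):s\in F,\ x\in\operatorname{wt}_{\mathfrak{l}}P(\lambda(s),J)\}$. With respect to $\lambda\in D_J$ and for $K\subset I$: a node $k\in K$ is active if $k\notin J$, or $k\in J$ and $(\check\alpha_k,\lambda)>0$; $K_{\min}$ is the union of the connected components of the Dynkin diagram on $K$ containing an active node; $K_d=\{j\in J:(\check\alpha_j,\lambda)=0\text{ and }j\text{ is not connected by an edge to any node of }K_{\min}\}$; $K_{\max}=K_{\min}\sqcup K_d$. For $\lambda=\lambda(s)$ these sets do not depend on the choice of $s$ in the relative interior of a given face of $S$. A face of a convex set $C$ is a (nonempty) convex subset $F\subset C$ such that whenever a convex combination $\sum_it_ic_i$ (all $t_i>0$) of points of $C$ lies in $F$, all $c_i\in F$. Interior points of faces mean relative interior points. *)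

theory Defs
  imports "HOL-Analysis.Analysis" "HOL-Algebra.Bij" "HOL-Algebra.Generated_Groups"
begin

section \<open>Root data and the Weyl group\<close>

definition gcm :: "int^'i^'i \<Rightarrow> bool" where
  "gcm A \<longleftrightarrow> (\<forall>i. A $ i $ i = 2) \<and> (\<forall>i j. i \<noteq> j \<longrightarrow> A $ i $ j \<le> 0) \<and>
     (\<forall>i j. A $ i $ j = 0 \<longrightarrow> A $ j $ i = 0)"

text \<open>The Cartan subalgebra is coordinatised by a basis; its dual is the same coordinate space
  with the dual basis, so that the evaluation pairing is the bilinear (not hermitian)
  \<^const>\<open>scalar_product\<close>.\<close>

definition realization :: "int^'i^'i \<Rightarrow> ('i \<Rightarrow> complex^'d) \<Rightarrow> ('i \<Rightarrow> complex^'d) \<Rightarrow> bool" where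
  "realization A \<alpha> \<alpha>c \<longleftrightarrow>
     inj \<alpha> \<and> vec.independent (range \<alpha>) \<and>
     inj \<alpha>c \<and> vec.independent (range \<alpha>c) \<and>
     (\<forall>i j. scalar_product (\<alpha>c i) (\<alpha> j) = of_int (A $ i $ j)) \<and>
     CARD('d) + rank (map_matrix of_int A :: complex^'i^'i) = 2 * CARD('i)"

definition simple_reflection ::
  "('i \<Rightarrow> complex^'d) \<Rightarrow> ('i \<Rightarrow> complex^'d) \<Rightarrow> 'i \<Rightarrow> complex^'d \<Rightarrow> complex^'d" where
  "simple_reflection \<alpha> \<alpha>c k \<mu> = \<mu> - scalar_product (\<alpha>c k) \<mu> *s \<alpha> k"

definition weyl_group ::
  "('i \<Rightarrow> complex^'d) \<Rightarrow> ('i \<Rightarrow> complex^'d) \<Rightarrow> 'i set \<Rightarrow> (complex^'d \<Rightarrow> complex^'d) set" where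
  "weyl_group \<alpha> \<alpha>c K = generate (BijGroup UNIV) (simple_reflection \<alpha> \<alpha>c ` K)"


section \<open>Kac--Moody algebras\<close>

locale complex_lie_algebra = vector_space sc
  for sc :: "complex \<Rightarrow> 'g::ab_group_add \<Rightarrow> 'g" +
  fixes bracket :: "'g \<Rightarrow> 'g \<Rightarrow> 'g"
  assumes linear_left: "Vector_Spaces.linear sc sc (\<lambda>x. bracket x y)"
    and linear_right: "Vector_Spaces.linear sc sc (bracket x)"
    and alternating: "bracket x x = 0"
    and jacobi: "bracket x (bracket y z) + bracket y (bracket z x) + bracket z (bracket x y) = 0"

text \<open>Generators, Chevalley and Serre relations, with the Cartan subalgebra embedded by \<open>\<iota>\<close>.
  There are two conventions for the Kac--Moody algebra: the Lie algebra presented by these relations,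
  and its quotient by the largest ideal meeting the Cartan subalgebra trivially. They agree for
  symmetrizable \<open>A\<close>. Both satisfy this locale, as does exactly every algebra in between.\<close>

locale kac_moody_algebra = complex_lie_algebra sc bracket
  for sc :: "complex \<Rightarrow> 'g::ab_group_add \<Rightarrow> 'g" and bracket :: "'g \<Rightarrow> 'g \<Rightarrow> 'g" +
  fixes A :: "int^'i^'i" and \<alpha> \<alpha>c :: "'i \<Rightarrow> complex^'d"
    and \<iota> :: "complex^'d \<Rightarrow> 'g" and e f :: "'i \<Rightarrow> 'g"
  assumes gcm: "gcm A"
    and realization: "realization A \<alpha> \<alpha>c"
    and cartan_linear: "Vector_Spaces.linear (*s) sc \<iota>"
    and cartan_inj: "inj \<iota>"
    and cartan_abelian: "bracket (\<iota> h) (\<iota> h') = 0"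
    and cartan_e: "bracket (\<iota> h) (e i) = sc (scalar_product h (\<alpha> i)) (e i)"
    and cartan_f: "bracket (\<iota> h) (f i) = sc (- scalar_product h (\<alpha> i)) (f i)"
    and e_f: "bracket (e i) (f j) = (if i = j then \<iota> (\<alpha>c i) else 0)"
    and serre_e: "i \<noteq> j \<Longrightarrow> (bracket (e i) ^^ nat (1 - A $ i $ j)) (e j) = 0"
    and serre_f: "i \<noteq> j \<Longrightarrow> (bracket (f i) ^^ nat (1 - A $ i $ j)) (f j) = 0"
    and generated: "subspace U \<Longrightarrow> (\<And>x y. x \<in> U \<Longrightarrow> y \<in> U \<Longrightarrow> bracket x y \<in> U) \<Longrightarrow>
      range \<iota> \<subseteq> U \<Longrightarrow> range e \<subseteq> U \<Longrightarrow> range f \<subseteq> U \<Longrightarrow> U = UNIV"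


section \<open>Highest weight modules\<close>

text \<open>A highest weight module is cyclic over a Lie algebra of countable dimension, hence itself of
  countable dimension. So up to isomorphism every one of them lives on a linear subspace of
  \<^typ>\<open>complex poly\<close>, which serves here only as a vector space of countably infinite dimension.\<close>

type_synonym 'g action = "'g \<Rightarrow> complex poly \<Rightarrow> complex poly"

definition lie_module ::
  "(complex \<Rightarrow> 'g::ab_group_add \<Rightarrow> 'g) \<Rightarrow> ('g \<Rightarrow> 'g \<Rightarrow> 'g) \<Rightarrow> complex poly set \<Rightarrow> 'g action \<Rightarrow> bool" where
  "lie_module sc bracket V act \<longleftrightarrow> module.subspace smult V \<and>
     (\<forall>x. \<forall>v\<in>V. act x v \<in> V) \<and>
     (\<forall>x. \<forall>v\<in>V. \<forall>v'\<in>V. act x (v + v') = act x v + act x v') \<and>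
     (\<forall>x c. \<forall>v\<in>V. act x (smult c v) = smult c (act x v)) \<and>
     (\<forall>x y. \<forall>v\<in>V. act (x + y) v = act x v + act y v) \<and>
     (\<forall>x c. \<forall>v\<in>V. act (sc c x) v = smult c (act x v)) \<and>
     (\<forall>x y. \<forall>v\<in>V. act (bracket x y) v = act x (act y v) - act y (act x v))"

definition highest_weight_module ::
  "(complex \<Rightarrow> 'g::ab_group_add \<Rightarrow> 'g) \<Rightarrow> ('g \<Rightarrow> 'g \<Rightarrow> 'g) \<Rightarrow> (complex^'d \<Rightarrow> 'g) \<Rightarrow> ('i \<Rightarrow> 'g) \<Rightarrow>
   complex poly set \<Rightarrow> 'g action \<Rightarrow> bool" where
  "highest_weight_module sc bracket \<iota> e V act \<longleftrightarrow> lie_module sc bracket V act \<and>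
     (\<exists>\<Lambda>. \<exists>v\<in>V. v \<noteq> 0 \<and> (\<forall>i. act (e i) v = 0) \<and>
        (\<forall>h. act (\<iota> h) v = smult (scalar_product h \<Lambda>) v) \<and>
        (\<forall>U\<subseteq>V. module.subspace smult U \<and> v \<in> U \<and> (\<forall>x. \<forall>u\<in>U. act x u \<in> U) \<longrightarrow> U = V))"

definition weights ::
  "(complex^'d \<Rightarrow> 'g) \<Rightarrow> complex poly set \<Rightarrow> 'g action \<Rightarrow> (complex^'d) set" where
  "weights \<iota> V act =
     {\<mu>. \<exists>v\<in>V. v \<noteq> 0 \<and> (\<forall>h. act (\<iota> h) v = smult (scalar_product h \<mu>) v)}"

definition integrability :: "('i \<Rightarrow> 'g) \<Rightarrow> complex poly set \<Rightarrow> 'g action \<Rightarrow> 'i set" where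
  "integrability f V act = {i. \<forall>v\<in>V. \<exists>n. (act (f i) ^^ n) v = 0}"


section \<open>Weyl polyhedra and their families\<close>

definition weyl_polyhedron ::
  "(complex \<Rightarrow> 'g::ab_group_add \<Rightarrow> 'g) \<Rightarrow> ('g \<Rightarrow> 'g \<Rightarrow> 'g) \<Rightarrow> (complex^'d \<Rightarrow> 'g) \<Rightarrow>
   ('i \<Rightarrow> 'g) \<Rightarrow> ('i \<Rightarrow> 'g) \<Rightarrow> 'i set \<Rightarrow> (complex^'d) set \<Rightarrow> bool" where
  "weyl_polyhedron sc bracket \<iota> e f J X \<longleftrightarrow>
     (\<exists>(n::nat) t V act.
        (\<forall>k<n. t k > 0 \<and> highest_weight_module sc bracket \<iota> e (V k) (act k) \<and>
               integrability f (V k) (act k) = J) \<and>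
        (\<Sum>k<n. t k) = 1 \<and>
        X = {\<Sum>k<n. t k *\<^sub>R x k | x. \<forall>k<n. x k \<in> convex hull (weights \<iota> (V k) (act k))})"

definition weyl_family ::
  "(complex \<Rightarrow> 'g::ab_group_add \<Rightarrow> 'g) \<Rightarrow> ('g \<Rightarrow> 'g \<Rightarrow> 'g) \<Rightarrow> (complex^'d \<Rightarrow> 'g) \<Rightarrow>
   ('i \<Rightarrow> 'g) \<Rightarrow> ('i \<Rightarrow> 'g) \<Rightarrow> 'i set \<Rightarrow> 's::real_vector set \<Rightarrow> ('s \<times> (complex^'d)) set \<Rightarrow> bool" where
  "weyl_family sc bracket \<iota> e f J S \<P> \<longleftrightarrow>
     \<P> \<subseteq> S \<times> UNIV \<and>
     (\<forall>s\<in>S. weyl_polyhedron sc bracket \<iota> e f J (\<P> `` {s})) \<and>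
     (\<forall>s0\<in>S. \<forall>s1\<in>S. \<forall>t. 0 \<le> t \<and> t \<le> 1 \<longrightarrow>
        {t *\<^sub>R x + (1 - t) *\<^sub>R y | x y. x \<in> \<P> `` {s0} \<and> y \<in> \<P> `` {s1}} =
        \<P> `` {t *\<^sub>R s0 + (1 - t) *\<^sub>R s1})"

definition dom_chamber :: "('i \<Rightarrow> complex^'d) \<Rightarrow> 'i set \<Rightarrow> (complex^'d) set" where
  "dom_chamber \<alpha>c J = {\<mu>. \<forall>j\<in>J. scalar_product (\<alpha>c j) \<mu> \<in> \<real>\<^sub>\<ge>\<^sub>0}"

definition weyl_P ::
  "('i \<Rightarrow> complex^'d) \<Rightarrow> ('i \<Rightarrow> complex^'d) \<Rightarrow> complex^'d \<Rightarrow> 'i set \<Rightarrow> (complex^'d) set" where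
  "weyl_P \<alpha> \<alpha>c \<mu> J =
     (if J = UNIV then convex hull ((\<lambda>w. w \<mu>) ` weyl_group \<alpha> \<alpha>c UNIV)
      else convex hull (\<Union>w\<in>weyl_group \<alpha> \<alpha>c J. \<Union>i\<in>-J. w ` {\<mu> - r *\<^sub>R \<alpha> i | r. r \<ge> 0}))"


section \<open>Faces attached to Levi subalgebras\<close>

text \<open>The standard Levi subalgebra \<open>\<ll>\<^sub>K\<close> enters only through its set \<open>K\<close> of nodes.
  For a family of Weyl polyhedra for \<open>J\<close>, \<open>lam s\<close> is the point of \<open>dom_chamber \<alpha>c J\<close> for which the
  fiber over \<open>s\<close> is \<open>weyl_P \<alpha> \<alpha>c (lam s) J\<close>; every Weyl polyhedron for \<open>J\<close> has this form for a
  unique such point.\<close>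

definition fund_coweights :: "('i \<Rightarrow> complex^'d) \<Rightarrow> ('i \<Rightarrow> complex^'d \<Rightarrow> real) \<Rightarrow> bool" where
  "fund_coweights \<alpha> \<omega> \<longleftrightarrow> (\<forall>i. linear (\<omega> i)) \<and> (\<forall>i j. \<omega> i (\<alpha> j) = (if i = j then 1 else 0))"

definition wt_levi ::
  "('i::finite \<Rightarrow> complex^'d \<Rightarrow> real) \<Rightarrow> 'i set \<Rightarrow> (complex^'d) set \<Rightarrow> (complex^'d) set" where
  "wt_levi \<omega> K X = {x \<in> X. \<forall>y\<in>X. (\<Sum>i\<in>-K. \<omega> i y) \<le> (\<Sum>i\<in>-K. \<omega> i x)}"

definition wt_levi_face ::
  "('i \<Rightarrow> complex^'d) \<Rightarrow> ('i \<Rightarrow> complex^'d) \<Rightarrow> ('i::finite \<Rightarrow> complex^'d \<Rightarrow> real) \<Rightarrow> 'i set \<Rightarrow>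
   ('s \<Rightarrow> complex^'d) \<Rightarrow> 'i set \<Rightarrow> 's set \<Rightarrow> ('s \<times> (complex^'d)) set" where
  "wt_levi_face \<alpha> \<alpha>c \<omega> J lam K F = {(s, x). s \<in> F \<and> x \<in> wt_levi \<omega> K (weyl_P \<alpha> \<alpha>c (lam s) J)}"


section \<open>Minimal and maximal sets of nodes\<close>

definition dynkin_edges :: "int^'i^'i \<Rightarrow> ('i \<times> 'i) set" where
  "dynkin_edges A = {(i, j). i \<noteq> j \<and> A $ i $ j \<noteq> 0}"

definition dynkin_components :: "int^'i^'i \<Rightarrow> 'i set \<Rightarrow> 'i set set" where
  "dynkin_components A K = K // (Restr (dynkin_edges A) K)\<^sup>*"

definition active :: "('i \<Rightarrow> complex^'d) \<Rightarrow> 'i set \<Rightarrow> complex^'d \<Rightarrow> 'i \<Rightarrow> bool" where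
  "active \<alpha>c J \<mu> k \<longleftrightarrow>
     k \<notin> J \<or> scalar_product (\<alpha>c k) \<mu> \<in> \<real> \<and> Re (scalar_product (\<alpha>c k) \<mu>) > 0"

definition levi_min ::
  "int^'i^'i \<Rightarrow> ('i \<Rightarrow> complex^'d) \<Rightarrow> 'i set \<Rightarrow> complex^'d \<Rightarrow> 'i set \<Rightarrow> 'i set" where
  "levi_min A \<alpha>c J \<mu> K = \<Union> {C \<in> dynkin_components A K. \<exists>k\<in>C. active \<alpha>c J \<mu> k}"

definition levi_d ::
  "int^'i^'i \<Rightarrow> ('i \<Rightarrow> complex^'d) \<Rightarrow> 'i set \<Rightarrow> complex^'d \<Rightarrow> 'i set \<Rightarrow> 'i set" where
  "levi_d A \<alpha>c J \<mu> K = {j \<in> J. scalar_product (\<alpha>c j) \<mu> = 0 \<and>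
     (\<forall>k\<in>levi_min A \<alpha>c J \<mu> K. (j, k) \<notin> dynkin_edges A)}"

definition levi_max ::
  "int^'i^'i \<Rightarrow> ('i \<Rightarrow> complex^'d) \<Rightarrow> 'i set \<Rightarrow> complex^'d \<Rightarrow> 'i set \<Rightarrow> 'i set" where
  "levi_max A \<alpha>c J \<mu> K = levi_min A \<alpha>c J \<mu> K \<union> levi_d A \<alpha>c J \<mu> K"

end

theory Submission
  imports Defs
begin

text \<open>Write \<open>\<lambda>\<close> for a dominant weight and \<open>P\<close> for its polyhedron. The proof is
convex geometry on top of one fact about the Weyl group.

That fact is the existence of descending words. Every element of \<open>W\<^sub>J\<close> is a product of simple
reflections in which each factor moves every \<open>J\<close>-dominant point weakly downwards, that is, subtracts a
nonnegative multiple of a simple root (\<open>descending_word_exists\<close>). As usual for Coxeter groups, this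
reduces to rank two, where it is an inequality for infinite dihedral groups and a finite check together
with the braid relations for the others.

The points \<open>\<lambda>\<close> and \<open>\<lambda> - r \<alpha>\<^sub>i\<close> (\<open>i \<notin> J\<close>, \<open>r \<ge> 0\<close>) are all \<open>J\<close>-dominant, and
\<open>P\<close> is the convex hull of their \<open>W\<^sub>J\<close>-orbits. Following descending words, every point of \<open>P\<close> is \<open>\<lambda>\<close>
minus a nonnegative combination of simple roots. Moreover a node can only enter the support of this
combination if it is active or adjacent to a node that is already there. So every connected component of
the support contains an active node, a condition that survives convex combinations
(\<open>weyl_P_attached\<close>). The face for \<open>K\<close> consists of the points of \<open>P\<close> with support in \<open>K\<close>, hence in
\<open>K\<^sub>m\<^sub>i\<^sub>n\<close>. Conversely, adding nodes one at a time produces a point of the face whose support is all of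
\<open>K\<^sub>m\<^sub>i\<^sub>n\<close> (\<open>generic_point\<close>). Therefore the face for \<open>K\<close> is contained in the face for \<open>L\<close> exactly if
\<open>K\<^sub>m\<^sub>i\<^sub>n \<subseteq> L\<close>; given this, \<open>L\<^sub>m\<^sub>i\<^sub>n \<subseteq> K\<close> amounts to \<open>L \<subseteq> K\<^sub>m\<^sub>a\<^sub>x\<close>, which settles equality.

For the stabilizer, the generic point \<open>x\<close> can be chosen dominant and such that its pairing with the simple
coroot of each \<open>j \<in> J\<close> outside \<open>K\<^sub>m\<^sub>a\<^sub>x\<close> is positive. If \<open>w\<close> preserves the face, then \<open>w x\<close> differs from
\<open>x\<close> only along roots of \<open>K\<^sub>m\<^sub>i\<^sub>n\<close>. A descending word for \<open>w\<close> then has all letters in \<open>K\<^sub>m\<^sub>a\<^sub>x\<close>, since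
the first other letter to act would subtract a positive multiple of a root outside \<open>K\<^sub>m\<^sub>i\<^sub>n\<close>, and no later
letter could undo this (\<open>face_stabilizer_subset\<close>).

Over the base, \<open>\<lambda>(s)\<close> is the unique highest point of its fiber, so it depends affinely on \<open>s\<close>. If \<open>s\<close> is a
relative interior point of a face \<open>F\<close>, then each \<open>u \<in> F\<close> lies on a segment in \<open>F\<close> that passes through \<open>s\<close>
after \<open>u\<close>. Mixing a point over \<open>u\<close> with the apex over the far end lands over \<open>s\<close>, and the defect from
extremality is nonnegative on both ends; so an inclusion over \<open>s\<close> forces the same inclusion over \<open>u\<close>
(\<open>translated_face_bundle_subset_iff\<close>). This reduces everything to the single fiber over \<open>s\<close>.\<close>

section \<open>Real coordinates and reflections\<close>

lemma scalar_product_add: "scalar_product v (x + y) = scalar_product v x + scalar_product v y"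
  by (simp add: scalar_product_def algebra_simps sum.distrib)

lemma scalar_product_diff:
  "scalar_product v (x - y) = scalar_product v x - scalar_product v (y :: complex^'n)"
  by (simp add: scalar_product_def algebra_simps sum_subtractf)

lemma scalar_product_scale:
  "scalar_product v (c *s x) = c * scalar_product v (x :: complex^'n)"
  by (simp add: scalar_product_def algebra_simps sum_distrib_left)

lemma scalar_product_scaleR:
  "scalar_product v (r *\<^sub>R x) = of_real r * scalar_product v (x :: complex^'n)"
  by (simp add: scalar_product_def algebra_simps sum_distrib_left scaleR_conv_of_real[where 'a = complex])

lemma scaleR_eq_scale: "r *\<^sub>R (x :: complex^'n) = of_real r *s x"
  by (simp add: vec_eq_iff scaleR_conv_of_real[where 'a = complex])

primrec alternating :: "nat \<Rightarrow> 'a \<Rightarrow> 'a \<Rightarrow> 'a list" where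
  "alternating 0 j k = []"
| "alternating (Suc m) j k = j # alternating m k j"

lemma length_alternating [simp]: "length (alternating m j k) = m"
  by (induction m arbitrary: j k) auto

locale root_system =
  fixes A :: "int^'i^'i" and \<alpha> \<alpha>c :: "'i::finite \<Rightarrow> complex^'d"
    and \<omega> :: "'i \<Rightarrow> complex^'d \<Rightarrow> real"
  assumes gcm: "gcm A"
    and pairing: "scalar_product (\<alpha>c i) (\<alpha> j) = of_int (A $ i $ j)"
    and fund_coweights: "fund_coweights \<alpha> \<omega>"
begin

abbreviation reflect :: "'i \<Rightarrow> complex^'d \<Rightarrow> complex^'d" where
  "reflect \<equiv> simple_reflection \<alpha> \<alpha>c"

abbreviation act :: "'i list \<Rightarrow> complex^'d \<Rightarrow> complex^'d" where
  "act \<equiv> foldr reflect"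

text \<open>On the points that matter the pairings with the coroots of \<open>J\<close> are real, so that the real part loses
  nothing; taking it everywhere makes \<open>h k\<close> a real linear functional on the whole space.\<close>

definition h :: "'i \<Rightarrow> complex^'d \<Rightarrow> real" where
  "h k x = Re (scalar_product (\<alpha>c k) x)"

lemma diag [simp]: "A $ i $ i = 2"
  using gcm by (simp add: gcm_def)

lemma off_diag: "i \<noteq> j \<Longrightarrow> A $ i $ j \<le> 0"
  using gcm by (simp add: gcm_def)

lemma zero_sym: "A $ i $ j = 0 \<longleftrightarrow> A $ j $ i = 0"
  using gcm by (auto simp: gcm_def)

lemma coweight_linear: "linear (\<omega> i)"
  and coweight_root [simp]: "\<omega> i (\<alpha> j) = (if i = j then 1 else 0)"
  using fund_coweights by (auto simp: fund_coweights_def)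

lemma h_add: "h k (x + y) = h k x + h k y"
  and h_diff: "h k (x - y) = h k x - h k y"
  and h_scaleR: "h k (r *\<^sub>R x) = r * h k x"
  by (simp_all add: h_def scalar_product_add scalar_product_diff scalar_product_scaleR)

lemma h_root [simp]: "h k (\<alpha> j) = A $ k $ j"
  by (simp add: h_def pairing)

lemma h_reflect: "h k (reflect j x) = h k x - A $ k $ j * h j x"
  by (simp add: h_def simple_reflection_def scalar_product_diff scalar_product_scale pairing)

lemma reflect_reflect [simp]: "reflect j (reflect j x) = x"
  by (simp add: simple_reflection_def scalar_product_diff scalar_product_scale pairing
      vec.scale_left_diff_distrib[symmetric] vec_eq_iff algebra_simps)

lemma reflect_real:
  "scalar_product (\<alpha>c j) x \<in> \<real> \<Longrightarrow> reflect j x = x - h j x *\<^sub>R \<alpha> j"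
  by (auto simp: h_def simple_reflection_def scaleR_eq_scale complex_is_Real_iff complex_eq_iff vec_eq_iff)

section \<open>Rank two Weyl groups\<close>

text \<open>The order of the product of the reflections in \<open>j\<close> and \<open>k\<close>, when that order is finite: the
  product \<open>a\<^sub>j\<^sub>k a\<^sub>k\<^sub>j\<close> is \<open>4 cos\<^sup>2(\<pi>/m)\<close> for \<open>m = 2, 3, 4, 6\<close>.\<close>

definition braid_length :: "'i \<Rightarrow> 'i \<Rightarrow> nat" where
  "braid_length j k = (let p = A $ j $ k * A $ k $ j in
     if p = 0 then 2 else if p = 1 then 3 else if p = 2 then 4 else 6)"

definition braid_bound :: "'i \<Rightarrow> 'i \<Rightarrow> nat \<Rightarrow> bool" where
  "braid_bound j k m \<longleftrightarrow> 4 \<le> A $ j $ k * A $ k $ j \<or> m \<le> braid_length j k"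

lemma braid_bound_sym: "braid_bound j k = braid_bound k j"
  by (simp add: fun_eq_iff braid_bound_def braid_length_def mult.commute)

lemma finite_rank_two_cases:
  assumes "j \<noteq> k" "A $ j $ k * A $ k $ j < 4"
  shows "(A $ j $ k, A $ k $ j) \<in> {(0,0), (-1,-1), (-1,-2), (-2,-1), (-1,-3), (-3,-1)}"
proof (cases "A $ j $ k = 0")
  case True
  then show ?thesis using zero_sym[of j k] by simp
next
  case False
  define a b where "a = - A $ j $ k" and "b = - A $ k $ j"
  have ab: "a \<ge> 1" "b \<ge> 1" "a * b < 4"
    using False assms zero_sym[of j k] off_diag[of j k] off_diag[of k j] by (auto simp: a_def b_def)
  have "a * 1 \<le> a * b" "1 * b \<le> a * b"
    using ab by (intro mult_mono; simp)+
  then have "a = 1 \<or> a = 2 \<or> a = 3" "b = 1 \<or> b = 2 \<or> b = 3" using ab by linarith+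
  then have "(a, b) \<in> {(1,1), (1,2), (2,1), (1,3), (3,1)}" using ab by auto
  then show ?thesis by (auto simp: a_def b_def)
qed

text \<open>The bare inequality is not inductive. With \<open>a = -a\<^sub>j\<^sub>k\<close>, \<open>b = -a\<^sub>k\<^sub>j\<close> and \<open>z\<close> the pairing that
  should stay nonnegative, the second conjunct \<open>a z + 2 x \<ge> 0\<close> controls the pairing \<open>x\<close> of the letter just
  used. A step turns \<open>(z, x)\<close> into \<open>(x + b z, -z)\<close> with the roles of \<open>a\<close> and \<open>b\<close> alternating, and the bound \<open>a b \<ge> 4\<close> is what reproduces it.\<close>

lemma alternating_infinite:
  assumes "j \<noteq> k" "4 \<le> A $ j $ k * A $ k $ j" "0 \<le> h j y" "0 \<le> h k y"
  shows "0 \<le> h k (act (alternating m j k) y) \<and>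
    0 \<le> - A $ j $ k * h k (act (alternating m j k) y) + 2 * h j (act (alternating m j k) y)"
  using assms
proof (induction m arbitrary: j k)
  case 0
  have "real_of_int (A $ j $ k) * h k y \<le> 0"
    using 0 off_diag[of j k] by (intro mult_nonpos_nonneg) auto
  then show ?case using 0 by simp
next
  case (Suc m)
  define x z where "x = h k (act (alternating m k j) y)" and "z = h j (act (alternating m k j) y)"
  define a b where "a = - real_of_int (A $ j $ k)" and "b = - real_of_int (A $ k $ j)"
  have IH: "0 \<le> z" "0 \<le> b * z + 2 * x"
    using Suc.IH[of k j] Suc.prems by (auto simp: x_def z_def b_def mult.commute)
  have a: "a \<ge> 0" and b: "b \<ge> 0"
    using off_diag[of j k] off_diag[of k j] Suc.prems(1) by (auto simp: a_def b_def)
  have "a * b = of_int (A $ j $ k * A $ k $ j)" by (simp add: a_def b_def)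
  then have ab: "4 \<le> a * b" using Suc.prems(2) by linarith
  have k: "h k (act (alternating (Suc m) j k) y) = x + b * z"
    by (simp add: h_reflect x_def z_def b_def)
  have j: "h j (act (alternating (Suc m) j k) y) = - z"
    by (simp add: h_reflect z_def)
  have "0 \<le> b * z" using b IH by simp
  have "4 * z \<le> a * b * z" using ab IH by (intro mult_right_mono) auto
  moreover have "0 \<le> a * (b * z + 2 * x)" using a IH by simp
  ultimately have "0 \<le> a * (x + b * z) + 2 * - z"
    by (simp add: algebra_simps)
  moreover have "0 \<le> x + b * z" using \<open>0 \<le> b * z\<close> IH by linarith
  ultimately show ?case unfolding j k by (simp add: a_def)
qed

text \<open>Each pairing is a linear form in the two initial pairings, and before the longest element is reached its
  coefficients are nonnegative in each of the six possible rank two types.\<close>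

lemma alternating_finite:
  assumes "j \<noteq> k" "A $ j $ k * A $ k $ j < 4" "m < braid_length j k" "0 \<le> h j y" "0 \<le> h k y"
  shows "0 \<le> h k (act (alternating m j k) y)"
proof -
  have "m < 6" using assms(3) by (auto simp: braid_length_def Let_def split: if_splits)
  then consider "m = 0" | "m = Suc 0" | "m = Suc (Suc 0)" | "m = Suc (Suc (Suc 0))"
    | "m = Suc (Suc (Suc (Suc 0)))" | "m = Suc (Suc (Suc (Suc (Suc 0))))"
    by linarith
  then show ?thesis
    by cases (use finite_rank_two_cases[OF assms(1,2)] assms in
        \<open>auto simp: h_reflect braid_length_def\<close>)
qed

lemma alternating_pos:
  assumes "j \<noteq> k" "braid_bound j k (Suc m)" "0 \<le> h j y" "0 \<le> h k y"
  shows "0 \<le> h k (act (alternating m j k) y)"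
  using assms alternating_infinite[of j k y m] alternating_finite[of j k m y]
  by (fastforce simp: braid_bound_def)

lemma reflect_combination:
  assumes "j \<noteq> k"
  shows "reflect j (x + c *s \<alpha> j + d *s \<alpha> k) =
    x + (- scalar_product (\<alpha>c j) x - c - of_int (A $ j $ k) * d) *s \<alpha> j + d *s \<alpha> k"
   "reflect k (x + c *s \<alpha> j + d *s \<alpha> k) =
    x + c *s \<alpha> j + (- scalar_product (\<alpha>c k) x - d - of_int (A $ k $ j) * c) *s \<alpha> k"
  by (simp_all add: simple_reflection_def scalar_product_add scalar_product_scale pairing
      vec_eq_iff algebra_simps)

text \<open>Any word in the two reflections moves \<open>x\<close> inside the plane through \<open>x\<close> spanned by the two roots, so the
  relation is an identity between two coefficients, checked type by type.\<close>

lemma braid_relation: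
  assumes "j \<noteq> k" "A $ j $ k * A $ k $ j < 4"
  shows "act (alternating (braid_length j k) j k) = act (alternating (braid_length j k) k j)"
proof
  fix x
  \<comment> \<open>Opaque coordinates on the plane through \<open>x\<close>, so that rewriting only touches the two coefficients.\<close>
  define point where "point = (\<lambda>c d. x + c *s \<alpha> j + d *s \<alpha> k)"
  have step:
    "reflect j (point c d) = point (- scalar_product (\<alpha>c j) x - c - of_int (A $ j $ k) * d) d"
    "reflect k (point c d) = point c (- scalar_product (\<alpha>c k) x - d - of_int (A $ k $ j) * c)" for c d
    by (simp_all add: point_def reflect_combination[OF assms(1)])
  have "act (alternating (braid_length j k) j k) (point 0 0) =
    act (alternating (braid_length j k) k j) (point 0 0)"
    using finite_rank_two_cases[OF assms]
    by (auto simp: braid_length_def eval_nat_numeral step algebra_simps intro!: arg_cong2[where f = point])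
  then show "act (alternating (braid_length j k) j k) x = act (alternating (braid_length j k) k j) x"
    by (simp add: point_def)
qed

section \<open>Descending words in the Weyl group\<close>

definition dominant :: "'i set \<Rightarrow> (complex^'d) set" where
  "dominant J = {x. \<forall>j\<in>J. 0 \<le> h j x}"

text \<open>The requirement is imposed on all dominant points at once rather than on the orbit of one of them. One
  word for a group element then serves every starting point, including those on walls.\<close>

primrec descending :: "'i set \<Rightarrow> 'i list \<Rightarrow> bool" where
  "descending J [] \<longleftrightarrow> True"
| "descending J (j # js) \<longleftrightarrow> j \<in> J \<and> descending J js \<and> (\<forall>x\<in>dominant J. 0 \<le> h j (act js x))"

lemma descending_set: "descending J js \<Longrightarrow> set js \<subseteq> J"
  by (induction js) auto

lemma braid_bound_mono: "braid_bound j k m \<Longrightarrow> n \<le> m \<Longrightarrow> braid_bound j k n"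
  by (auto simp: braid_bound_def)

text \<open>The dihedral group generated by two reflections consists of alternating words up to the length of the
  longest one: prepending a letter either extends the word, cancels its first letter, or, at the longest
  element, cancels after the braid relation has exchanged the two letters.\<close>

lemma alternating_normal_form:
  assumes "j \<noteq> k" "set ds \<subseteq> {j, k}"
  shows "\<exists>a b m. (a = j \<and> b = k \<or> a = k \<and> b = j) \<and> m \<le> length ds \<and> braid_bound a b m \<and>
    act ds = act (alternating m a b)"
  using assms(2)
proof (induction ds)
  case Nil
  have "braid_bound j k 0" by (simp add: braid_bound_def)
  then show ?case using assms(1) by (intro exI[of _ j] exI[of _ k] exI[of _ 0]) auto
next
  case (Cons d ds)
  then obtain a b m where ab: "a = j \<and> b = k \<or> a = k \<and> b = j"
    and m: "m \<le> length ds" "braid_bound a b m" and eq: "act ds = act (alternating m a b)"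
    by force
  have neq: "a \<noteq> b" using ab assms(1) by blast
  have two: "2 \<le> braid_length a b" by (simp add: braid_length_def Let_def)
  then have one: "braid_bound a b 1" "braid_bound b a 1"
    by (auto simp: braid_bound_def[of a b] braid_bound_sym[of b a])
  have "d = a \<or> d = b" using Cons.prems ab by fastforce
  then show ?case
  proof
    assume d: "d = a"
    show ?thesis
    proof (cases m)
      case 0
      then have "act (d # ds) = act (alternating 1 a b)" using d eq by simp
      then show ?thesis using ab one by (intro exI[of _ a] exI[of _ b] exI[of _ 1]) auto
    next
      case (Suc m')
      then have "act (d # ds) = act (alternating m' b a)" using d eq by (auto simp: fun_eq_iff)
      moreover have "braid_bound b a m'" using braid_bound_mono[OF m(2), of m'] Suc braid_bound_sym[of a b] by auto
      ultimately show ?thesis using ab m Suc by (intro exI[of _ b] exI[of _ a] exI[of _ m']) auto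
    qed
  next
    assume d: "d = b"
    show ?thesis
    proof (cases "braid_bound a b (Suc m)")
      case True
      then have "braid_bound b a (Suc m)" using braid_bound_sym by auto
      moreover have "act (d # ds) = act (alternating (Suc m) b a)" using d eq by auto
      ultimately show ?thesis using ab m by (intro exI[of _ b] exI[of _ a] exI[of _ "Suc m"]) auto
    next
      case False
      then have fin: "A $ a $ b * A $ b $ a < 4" and len: "m = braid_length a b"
        using m(2) by (auto simp: braid_bound_def)
      obtain m' where Suc: "m = Suc m'" using two len not0_implies_Suc[of m] by auto
      have "act ds = act (alternating m b a)"
        using braid_relation[OF neq fin] eq len by simp
      then have "act (d # ds) = act (alternating m' a b)" using d Suc by (auto simp: fun_eq_iff)
      moreover have "braid_bound a b m'" using braid_bound_mono[OF m(2), of m'] Suc by auto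
      ultimately show ?thesis using ab m Suc by (intro exI[of _ a] exI[of _ b] exI[of _ m']) auto
    qed
  qed
qed

lemma descending_alternating_append:
  assumes "a \<noteq> b" "a \<in> J" "b \<in> J" "braid_bound a b m" "descending J us"
    and "\<And>x. x \<in> dominant J \<Longrightarrow> 0 \<le> h a (act us x) \<and> 0 \<le> h b (act us x)"
  shows "descending J (alternating m a b @ us)"
  using assms
proof (induction m arbitrary: a b)
  case 0
  then show ?case by simp
next
  case (Suc m)
  have bound: "braid_bound b a (Suc m)" using Suc.prems(4) braid_bound_sym[of a b] by auto
  have "0 \<le> h a (act (alternating m b a @ us) x)" if "x \<in> dominant J" for x
    using alternating_pos[of b a m "act us x"] bound Suc.prems(1) Suc.prems(6)[OF that] by auto
  moreover have "descending J (alternating m b a @ us)"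
    using Suc.IH[of b a] Suc.prems braid_bound_mono[OF bound, of m] by auto
  ultimately show ?case using Suc.prems(2) by simp
qed

text \<open>The analogue of the fact that \<open>w\<^sup>-\<^sup>1\<close> maps a simple root to a positive or a negative root according
  to whether \<open>s\<^sub>k w\<close> is longer or shorter than \<open>w\<close>. Split off from the word a prefix in the two letters \<open>j\<close>
  (its first letter) and \<open>k\<close>, making the remaining word \<open>us\<close> as short as possible. By induction both \<open>j\<close> and
  \<open>k\<close> are then nonnegative after \<open>us\<close>, since otherwise \<open>us\<close> could be shortened. The question for the prefix is
  one about rank two.\<close>

lemma descending_dichotomy:
  assumes "descending J js" "k \<in> J"
  shows "(\<forall>x\<in>dominant J. 0 \<le> h k (act js x)) \<or>
    (\<exists>ks. descending J ks \<and> length ks < length js \<and> act ks = reflect k \<circ> act js)"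
  using assms
proof (induction js arbitrary: k rule: length_induct)
  case (1 js)
  note IH = "1.IH"[rule_format]
  show ?case
  proof (cases js)
    case Nil
    then show ?thesis using "1.prems" by (auto simp: dominant_def)
  next
    case (Cons j js')
    have j: "j \<in> J" and js': "descending J js'" using "1.prems" Cons by auto
    show ?thesis
    proof (cases "k = j")
      case True
      then have "act js' = reflect k \<circ> act js" using Cons by (auto simp: fun_eq_iff)
      moreover have "length js' < length js" using Cons by simp
      ultimately show ?thesis using js' by blast
    next
      case False
      define Q where "Q us ds \<longleftrightarrow> descending J us \<and> set ds \<subseteq> {j, k} \<and>
        act js = act ds \<circ> act us \<and> length ds + length us \<le> length js" for us ds
      have "Q js' [j]" using js' Cons by (auto simp: Q_def fun_eq_iff)
      then have "\<exists>ds. Q js' ds" by blast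
      then obtain us where us: "\<exists>ds. Q us ds" and least: "\<And>vs. \<exists>ds. Q vs ds \<Longrightarrow> length us \<le> length vs"
        using ex_has_least_nat[of "\<lambda>us. \<exists>ds. Q us ds" js' length] by auto
      from us obtain ds where ds: "Q us ds" by blast
      have short: "length us < length js" using least[of js'] \<open>Q js' [j]\<close> Cons by fastforce
      have pos: "0 \<le> h c (act us x)" if c: "c \<in> {j, k}" and x: "x \<in> dominant J" for c x
      proof (rule ccontr)
        assume neg: "\<not> 0 \<le> h c (act us x)"
        have "c \<in> J" using c j "1.prems" by auto
        then obtain ks where ks: "descending J ks" "length ks < length us" "act ks = reflect c \<circ> act us"
          using IH[OF short, of c] ds neg x by (auto simp: Q_def)
        \<comment> \<open>Here \<open>ds @ [c]\<close> undoes the reflection that turned \<open>us\<close> into \<open>ks\<close>, at no cost in total length.\<close>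
        have "Q ks (ds @ [c])"
          using ks ds c by (auto simp: Q_def fun_eq_iff)
        then show False using least[of ks] ks(2) by fastforce
      qed
      obtain a b m where ab_cases: "a = j \<and> b = k \<or> a = k \<and> b = j"
        and m: "m \<le> length ds" "braid_bound a b m"
        and eq: "act ds = act (alternating m a b)"
        using alternating_normal_form[of j k ds] False ds by (auto simp: Q_def)
      have ab: "a \<noteq> b" using ab_cases False by blast
      have act_js: "act js = act (alternating m a b) \<circ> act us"
        using ds eq by (simp add: Q_def)
      have us_desc: "descending J us" using ds by (simp add: Q_def)
      \<comment> \<open>If \<open>k\<close> can be the leftmost letter, cancelling it shortens the word.\<close>
      have cancel: ?thesis if m': "m = Suc m'" and js_eq: "act js = act (alternating m k j) \<circ> act us" for m'
      proof -
        have "braid_bound j k m'"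
          using braid_bound_mono[OF m(2), of m'] m' ab_cases braid_bound_sym[of a b] by auto
        then have "descending J (alternating m' j k @ us)"
          using False j "1.prems"(2) us_desc pos
          by (intro descending_alternating_append) auto
        moreover have "act (alternating m' j k @ us) = reflect k \<circ> act js"
          using m' js_eq by (auto simp: fun_eq_iff)
        moreover have "length (alternating m' j k @ us) < length js"
          using ds m m' by (auto simp: Q_def)
        ultimately show ?thesis by blast
      qed
      show ?thesis
      proof (cases "b = k \<and> braid_bound a b (Suc m) \<or> m = 0")
        case True
        have "0 \<le> h k (act js x)" if x: "x \<in> dominant J" for x
        proof (cases "m = 0")
          case True
          then show ?thesis using act_js pos[OF _ x, of k] by auto
        next
          case False
          then have "b = k" "a = j" "braid_bound j k (Suc m)" using True ab ab_cases by auto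
          then show ?thesis
            using alternating_pos[of j k m "act us x"] pos[OF _ x] act_js ab by auto
        qed
        then show ?thesis by blast
      next
        case no: False
        then obtain m' where m': "m = Suc m'" by (cases m) auto
        show ?thesis
        proof (cases "a = k")
          case True
          then show ?thesis using cancel[OF m'] act_js ab_cases by auto
        next
          case False
          then have ajk: "a = j" "b = k" using ab_cases by auto
          then have "A $ j $ k * A $ k $ j < 4" "m = braid_length j k"
            using no m(2) by (auto simp: braid_bound_def)
          \<comment> \<open>At the longest element of the dihedral group either letter can come first.\<close>
          then have "act (alternating m j k) = act (alternating m k j)"
            using braid_relation[of j k] ab ajk by auto
          then show ?thesis using cancel[OF m'] act_js ajk by auto
        qed
      qed
    qed
  qed
qed

lemma descending_word_exists:
  assumes "set js \<subseteq> J"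
  shows "\<exists>ks. descending J ks \<and> act ks = act js"
  using assms
proof (induction js)
  case Nil
  show ?case by (intro exI[of _ "[]"]) auto
next
  case (Cons j js)
  then obtain ks where ks: "descending J ks" "act ks = act js" and j: "j \<in> J" by auto
  from descending_dichotomy[OF ks(1) j] show ?case
  proof
    assume "\<forall>x\<in>dominant J. 0 \<le> h j (act ks x)"
    then show ?thesis using ks j by (intro exI[of _ "j # ks"]) auto
  next
    assume "\<exists>ls. descending J ls \<and> length ls < length ks \<and> act ls = reflect j \<circ> act ks"
    then show ?thesis using ks by auto
  qed
qed

lemma reflect_Bij: "reflect j \<in> carrier (BijGroup UNIV)"
  by (auto simp: BijGroup_def Bij_def intro!: bij_betwI[where g = "reflect j"])

lemma act_Bij: "act js \<in> carrier (BijGroup UNIV)"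
proof (induction js)
  case Nil
  show ?case by (auto simp: BijGroup_def Bij_def bij_betw_def)
next
  case (Cons j js)
  then show ?case
    using reflect_Bij[of j] bij_comp[of "act js" "reflect j"] by (auto simp: BijGroup_def Bij_def o_def)
qed

lemma mult_BijGroup:
  assumes "f \<in> carrier (BijGroup UNIV)" "g \<in> carrier (BijGroup UNIV)"
  shows "f \<otimes>\<^bsub>BijGroup UNIV\<^esub> g = f \<circ> g"
  using assms by (auto simp: BijGroup_def compose_def)

lemma weyl_group_words: "weyl_group \<alpha> \<alpha>c K = {act js | js. set js \<subseteq> K}"
proof -
  interpret B: group "BijGroup (UNIV :: (complex^'d) set)" by (rule group_BijGroup)
  have one: "\<one>\<^bsub>BijGroup UNIV\<^esub> = (act [] :: complex^'d \<Rightarrow> complex^'d)"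
    by (auto simp: BijGroup_def)
  have inv: "inv\<^bsub>BijGroup UNIV\<^esub> (reflect j) = reflect j" for j
    using reflect_Bij[of j] by (intro B.inv_equality) (auto simp: mult_BijGroup one)
  have "\<exists>js. set js \<subseteq> K \<and> w = act js" if "w \<in> generate (BijGroup UNIV) (reflect ` K)" for w
    using that
  proof (induction rule: generate.induct)
    case one
    show ?case by (intro exI[of _ "[]"]) (simp add: \<open>\<one>\<^bsub>BijGroup UNIV\<^esub> = act []\<close>)
  next
    case (incl w)
    then obtain j where "j \<in> K" "w = reflect j" by auto
    then show ?case by (intro exI[of _ "[j]"]) auto
  next
    case (inv w)
    then obtain j where "j \<in> K" "w = reflect j" by auto
    then show ?case using \<open>inv\<^bsub>BijGroup UNIV\<^esub> (reflect j) = reflect j\<close> by (intro exI[of _ "[j]"]) auto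
  next
    case (eng v w)
    then obtain js ks where "set js \<subseteq> K" "set ks \<subseteq> K" "v = act js" "w = act ks" by auto
    moreover have "act js \<otimes>\<^bsub>BijGroup UNIV\<^esub> act ks = act (js @ ks)"
      unfolding mult_BijGroup[OF act_Bij act_Bij] by (simp add: fun_eq_iff)
    ultimately show ?case by (intro exI[of _ "js @ ks"]) auto
  qed
  moreover have "act js \<in> generate (BijGroup UNIV) (reflect ` K)" if "set js \<subseteq> K" for js
    using that
  proof (induction js)
    case Nil
    show ?case by (metis one generate.one)
  next
    case (Cons j js)
    then have "reflect j \<in> generate (BijGroup UNIV) (reflect ` K)"
      and "act js \<in> generate (BijGroup UNIV) (reflect ` K)"
      by (auto intro: generate.incl)
    from generate.eng[OF this] show ?case
      by (simp add: mult_BijGroup[OF reflect_Bij act_Bij] o_def)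
  qed
  ultimately show ?thesis unfolding weyl_group_def by blast
qed

section \<open>Nodes connected to active nodes\<close>

abbreviation levi_min' where "levi_min' \<equiv> levi_min A \<alpha>c"

lemma edge_sym: "(j, k) \<in> dynkin_edges A \<longleftrightarrow> (k, j) \<in> dynkin_edges A"
  using zero_sym[of j k] by (auto simp: dynkin_edges_def)

lemma levi_min_iff:
  "k \<in> levi_min' J \<mu> K \<longleftrightarrow>
    (\<exists>a\<in>K. active \<alpha>c J \<mu> a \<and> (a, k) \<in> (Restr (dynkin_edges A) K)\<^sup>*)"
proof -
  have "sym (Restr (dynkin_edges A) K)"
    using edge_sym by (auto simp: sym_def)
  then have s: "(x, y) \<in> (Restr (dynkin_edges A) K)\<^sup>* \<longleftrightarrow> (y, x) \<in> (Restr (dynkin_edges A) K)\<^sup>*" for x y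
    using sym_rtrancl[of "Restr (dynkin_edges A) K"] by (meson symD)
  show ?thesis
  proof
    assume "k \<in> levi_min' J \<mu> K"
    then obtain C a where C: "C \<in> dynkin_components A K" "k \<in> C" "a \<in> C" "active \<alpha>c J \<mu> a"
      by (auto simp: levi_min_def)
    then obtain x where x: "x \<in> K" "(x, k) \<in> (Restr (dynkin_edges A) K)\<^sup>*" "(x, a) \<in> (Restr (dynkin_edges A) K)\<^sup>*"
      by (auto simp: dynkin_components_def quotient_def)
    have "a \<in> K" using x(3,1) by (induction rule: rtrancl_induct) auto
    moreover have "(a, k) \<in> (Restr (dynkin_edges A) K)\<^sup>*" using x s by (meson rtrancl_trans)
    ultimately show "\<exists>a\<in>K. active \<alpha>c J \<mu> a \<and> (a, k) \<in> (Restr (dynkin_edges A) K)\<^sup>*"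
      using C by blast
  next
    assume "\<exists>a\<in>K. active \<alpha>c J \<mu> a \<and> (a, k) \<in> (Restr (dynkin_edges A) K)\<^sup>*"
    then obtain a where a: "a \<in> K" "active \<alpha>c J \<mu> a" "(a, k) \<in> (Restr (dynkin_edges A) K)\<^sup>*"
      by blast
    have "(Restr (dynkin_edges A) K)\<^sup>* `` {a} \<in> dynkin_components A K"
      using a by (auto simp: dynkin_components_def intro: quotientI)
    then show "k \<in> levi_min' J \<mu> K"
      using a unfolding levi_min_def by blast
  qed
qed

lemma levi_min_subset: "levi_min' J \<mu> K \<subseteq> K"
proof
  fix k assume "k \<in> levi_min' J \<mu> K"
  then obtain a where "(a, k) \<in> (Restr (dynkin_edges A) K)\<^sup>*" "a \<in> K"
    using levi_min_iff by blast
  then show "k \<in> K" by (induction rule: rtrancl_induct) auto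
qed

lemma levi_min_active: "k \<in> K \<Longrightarrow> active \<alpha>c J \<mu> k \<Longrightarrow> k \<in> levi_min' J \<mu> K"
  using levi_min_iff by blast

lemma levi_min_step:
  assumes "j \<in> levi_min' J \<mu> K" "k \<in> K" "(j, k) \<in> dynkin_edges A"
  shows "k \<in> levi_min' J \<mu> K"
proof -
  have "j \<in> K" using assms(1) levi_min_subset by blast
  then have "(j, k) \<in> Restr (dynkin_edges A) K" using assms by auto
  then show ?thesis using assms(1) unfolding levi_min_iff by (meson rtrancl.rtrancl_into_rtrancl)
qed

text \<open>The induction principle that replaces all further reasoning with paths in the Dynkin diagram.\<close>

lemma levi_min_least:
  assumes "\<And>k. k \<in> K \<Longrightarrow> active \<alpha>c J \<mu> k \<Longrightarrow> k \<in> M"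
    and "\<And>j k. j \<in> M \<Longrightarrow> k \<in> K \<Longrightarrow> (j, k) \<in> dynkin_edges A \<Longrightarrow> k \<in> M"
  shows "levi_min' J \<mu> K \<subseteq> M"
proof
  fix k assume "k \<in> levi_min' J \<mu> K"
  then obtain a where a: "a \<in> K" "active \<alpha>c J \<mu> a" and r: "(a, k) \<in> (Restr (dynkin_edges A) K)\<^sup>*"
    using levi_min_iff by blast
  from r show "k \<in> M"
    by (induction rule: rtrancl_induct) (use a assms in auto)
qed

text \<open>The inclusion is assumed only for \<open>K\<^sub>m\<^sub>i\<^sub>n\<close>, so that monotonicity in \<open>K\<close> and idempotence
  are both instances.\<close>

lemma levi_min_mono:
  assumes "levi_min' J \<mu> K \<subseteq> L"
  shows "levi_min' J \<mu> K \<subseteq> levi_min' J \<mu> L"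
proof -
  have "levi_min' J \<mu> K \<subseteq> levi_min' J \<mu> K \<inter> levi_min' J \<mu> L"
  proof (rule levi_min_least)
    fix k assume "k \<in> K" "active \<alpha>c J \<mu> k"
    then show "k \<in> levi_min' J \<mu> K \<inter> levi_min' J \<mu> L"
      using assms levi_min_active by blast
  next
    fix j k assume "j \<in> levi_min' J \<mu> K \<inter> levi_min' J \<mu> L" "k \<in> K" "(j, k) \<in> dynkin_edges A"
    then show "k \<in> levi_min' J \<mu> K \<inter> levi_min' J \<mu> L"
      using assms levi_min_step[of j J \<mu> K k] levi_min_step[of j J \<mu> L k] by blast
  qed
  then show ?thesis by blast
qed

lemma dom_chamber_iff:
  "\<mu> \<in> dom_chamber \<alpha>c J \<longleftrightarrow> (\<forall>j\<in>J. scalar_product (\<alpha>c j) \<mu> \<in> \<real> \<and> 0 \<le> h j \<mu>)"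
  by (auto simp: dom_chamber_def h_def complex_nonneg_Reals_iff complex_is_Real_iff)

lemma active_iff:
  assumes "\<mu> \<in> dom_chamber \<alpha>c J"
  shows "active \<alpha>c J \<mu> k \<longleftrightarrow> k \<notin> J \<or> 0 < h k \<mu>"
  using assms by (auto simp: active_def dom_chamber_iff h_def)

lemma pairing_zero_iff:
  assumes "\<mu> \<in> dom_chamber \<alpha>c J" "k \<in> J"
  shows "scalar_product (\<alpha>c k) \<mu> = 0 \<longleftrightarrow> h k \<mu> = 0"
  using assms by (auto simp: dom_chamber_iff h_def complex_is_Real_iff complex_eq_iff)

text \<open>The case \<open>j = k\<close> has to be excluded, since an edge joins different nodes. A node of \<open>K\<^sub>d\<close> is inactive
  and isolated from \<open>K\<^sub>m\<^sub>i\<^sub>n\<close>, so it could be removed from \<open>K\<^sub>m\<^sub>i\<^sub>n\<close>, contrary to minimality.\<close>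

lemma levi_d_orthogonal_levi_min:
  assumes "\<mu> \<in> dom_chamber \<alpha>c J" "j \<in> levi_d A \<alpha>c J \<mu> K" "k \<in> levi_min' J \<mu> K"
  shows "A $ j $ k = 0"
proof (cases "j = k")
  case False
  then show ?thesis using assms by (auto simp: levi_d_def dynkin_edges_def)
next
  case True
  let ?M = "levi_min' J \<mu> K"
  have no_edge: "(i, j) \<notin> dynkin_edges A" if "i \<in> ?M" for i
    using assms(2) that edge_sym by (auto simp: levi_d_def)
  have inactive: "\<not> active \<alpha>c J \<mu> j"
    using assms(1,2) by (auto simp: levi_d_def active_iff h_def)
  have "?M \<subseteq> ?M - {j}"
  proof (rule levi_min_least)
    fix i assume "i \<in> K" "active \<alpha>c J \<mu> i"
    then show "i \<in> ?M - {j}" using levi_min_active[of i K J \<mu>] inactive by auto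
  next
    fix i k assume "i \<in> ?M - {j}" "k \<in> K" "(i, k) \<in> dynkin_edges A"
    then show "k \<in> ?M - {j}" using levi_min_step[of i J \<mu> K k] no_edge[of i] by auto
  qed
  then show ?thesis using assms(3) True by blast
qed

section \<open>Cone combinations of simple roots\<close>

abbreviation comb :: "('i \<Rightarrow> real) \<Rightarrow> complex^'d" where
  "comb c \<equiv> \<Sum>k\<in>UNIV. c k *\<^sub>R \<alpha> k"

lemma coweight_diff: "\<omega> i (x - y) = \<omega> i x - \<omega> i y"
  and coweight_add: "\<omega> i (x + y) = \<omega> i x + \<omega> i y"
  and coweight_scaleR: "\<omega> i (r *\<^sub>R x) = r * \<omega> i x"
  using coweight_linear by (auto simp: linear_diff linear_add linear_scale)

lemma coweight_comb [simp]: "\<omega> i (comb c) = c i"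
proof -
  have "\<omega> i (comb c) = (\<Sum>k\<in>UNIV. c k * \<omega> i (\<alpha> k))"
    by (simp only: linear_sum[OF coweight_linear] coweight_scaleR)
  also have "\<dots> = (\<Sum>k\<in>UNIV. if k = i then c k else 0)"
    by (intro sum.cong) auto
  finally show ?thesis by simp
qed

lemma h_comb: "h j (comb c) = (\<Sum>k\<in>UNIV. c k * A $ j $ k)"
proof -
  have "linear (h j)"
    by (intro linearI) (auto simp: h_add h_scaleR)
  then show ?thesis by (simp add: linear_sum h_scaleR)
qed

lemma h_comb_split: "h j (comb c) = 2 * c j + (\<Sum>k\<in>- {j}. c k * A $ j $ k)"
  unfolding h_comb by (subst sum.remove[of _ j]) (auto simp: Compl_eq_Diff_UNIV)

lemma h_comb_le: "(\<And>k. 0 \<le> c k) \<Longrightarrow> h j (comb c) \<le> 2 * c j"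
  unfolding h_comb_split by (auto intro!: sum_nonpos mult_nonneg_nonpos off_diag)

lemma h_comb_neg:
  assumes "\<And>k. 0 \<le> c k" "c j = 0" "c i \<noteq> 0" "(i, j) \<in> dynkin_edges A"
  shows "h j (comb c) < 0"
proof -
  have neg: "A $ j $ i < 0" "i \<noteq> j"
    using assms(4) edge_sym[of i j] off_diag[of j i] by (auto simp: dynkin_edges_def)
  have "(\<Sum>k\<in>- {j}. c k * A $ j $ k) = c i * A $ j $ i + (\<Sum>k\<in>- {j} - {i}. c k * A $ j $ k)"
    using neg by (intro sum.remove) auto
  moreover have "(\<Sum>k\<in>- {j} - {i}. c k * A $ j $ k) \<le> 0"
    using assms by (auto intro!: sum_nonpos mult_nonneg_nonpos off_diag)
  moreover have "c i * A $ j $ i < 0"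
    using neg assms by (intro mult_pos_neg) (auto simp: order_less_le)
  ultimately show ?thesis unfolding h_comb_split using assms(2) by simp
qed

lemma h_comb_zero:
  assumes "\<And>k. c k \<noteq> 0 \<Longrightarrow> A $ j $ k = 0"
  shows "h j (comb c) = 0"
proof -
  have "c k * A $ j $ k = 0" for k using assms[of k] by (cases "c k = 0") auto
  then show ?thesis unfolding h_comb by (intro sum.neutral ballI)
qed

lemma comb_add: "comb (\<lambda>k. c k + d k) = comb c + comb d"
  and comb_scaleR: "comb (\<lambda>k. r * c k) = r *\<^sub>R comb c"
  and comb_single: "comb (\<lambda>k. if k = j then r else 0) = r *\<^sub>R \<alpha> j"
proof -
  show "comb (\<lambda>k. c k + d k) = comb c + comb d"
    by (simp add: scaleR_add_left sum.distrib)
  show "comb (\<lambda>k. r * c k) = r *\<^sub>R comb c"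
    by (simp add: scaleR_sum_right)
  have "comb (\<lambda>k. if k = j then r else 0) = (\<Sum>k\<in>UNIV. if k = j then r *\<^sub>R \<alpha> k else 0)"
    by (intro sum.cong) auto
  then show "comb (\<lambda>k. if k = j then r else 0) = r *\<^sub>R \<alpha> j" by simp
qed

lemma pairing_comb_real: "scalar_product (\<alpha>c j) (comb c) \<in> \<real>"
proof -
  have "scalar_product (\<alpha>c j) (sum g T) = (\<Sum>k\<in>T. scalar_product (\<alpha>c j) (g k))"
    if "finite T" for g :: "'i \<Rightarrow> complex^'d" and T
    using that by (induction T) (auto simp: scalar_product_add, simp add: scalar_product_def)
  then have "scalar_product (\<alpha>c j) (comb c) = (\<Sum>k\<in>UNIV. of_real (c k) * of_int (A $ j $ k))"
    by (simp add: scalar_product_scaleR pairing)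
  then show ?thesis by (auto intro!: sum_in_Reals Reals_mult)
qed

section \<open>Weyl polyhedra below their apex\<close>

text \<open>The points below \<open>\<mu>\<close> for which each connected component of the support of the difference contains an active
  node: a set equals its own \<open>levi_min\<close> exactly if this holds.\<close>

definition attached :: "'i set \<Rightarrow> complex^'d \<Rightarrow> (complex^'d) set" where
  "attached J \<mu> = {\<mu> - comb c | c. (\<forall>k. 0 \<le> c k) \<and> {k. c k \<noteq> 0} \<subseteq> levi_min' J \<mu> {k. c k \<noteq> 0}}"

lemma attached_self: "\<mu> \<in> attached J \<mu>"
  unfolding attached_def by (intro CollectI exI[of _ "\<lambda>_. 0"]) auto

text \<open>In a proper convex combination of nonnegative coefficient vectors nothing cancels, so the support is the union
  of the supports, and a union of sets with the component condition again has it.\<close>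

lemma convex_attached: "convex (attached J \<mu>)"
proof (rule convexI)
  fix x y :: "complex^'d" and u v :: real
  assume "x \<in> attached J \<mu>" "y \<in> attached J \<mu>" and uv: "0 \<le> u" "0 \<le> v" "u + v = 1"
  then obtain c d where
    c: "x = \<mu> - comb c" "\<And>k. 0 \<le> c k" "{k. c k \<noteq> 0} \<subseteq> levi_min' J \<mu> {k. c k \<noteq> 0}" and
    d: "y = \<mu> - comb d" "\<And>k. 0 \<le> d k" "{k. d k \<noteq> 0} \<subseteq> levi_min' J \<mu> {k. d k \<noteq> 0}"
    by (auto simp: attached_def)
  define e where "e k = u * c k + v * d k" for k
  have "u *\<^sub>R \<mu> + v *\<^sub>R \<mu> = \<mu>" using uv by (metis scaleR_add_left scaleR_one)
  moreover have "comb e = u *\<^sub>R comb c + v *\<^sub>R comb d"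
    unfolding e_def comb_add comb_scaleR ..
  ultimately have eq: "u *\<^sub>R x + v *\<^sub>R y = \<mu> - comb e"
    by (simp add: c(1) d(1) algebra_simps)
  have ge: "0 \<le> e k" for k using uv c(2) d(2) by (simp add: e_def)
  have "{k. e k \<noteq> 0} \<subseteq> levi_min' J \<mu> {k. e k \<noteq> 0}"
  proof
    fix k assume "k \<in> {k. e k \<noteq> 0}"
    then have "u \<noteq> 0 \<and> c k \<noteq> 0 \<or> v \<noteq> 0 \<and> d k \<noteq> 0" by (auto simp: e_def)
    then show "k \<in> levi_min' J \<mu> {k. e k \<noteq> 0}"
    proof
      assume uc: "u \<noteq> 0 \<and> c k \<noteq> 0"
      then have "{k. c k \<noteq> 0} \<subseteq> {k. e k \<noteq> 0}"
        using uv c(2) d(2) by (auto simp: e_def add_nonneg_eq_0_iff)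
      then have "levi_min' J \<mu> {k. c k \<noteq> 0} \<subseteq> levi_min' J \<mu> {k. e k \<noteq> 0}"
        using levi_min_subset by (intro levi_min_mono) blast
      then show ?thesis using uc c(3) by blast
    next
      assume vd: "v \<noteq> 0 \<and> d k \<noteq> 0"
      then have "{k. d k \<noteq> 0} \<subseteq> {k. e k \<noteq> 0}"
        using uv c(2) d(2) by (auto simp: e_def add_nonneg_eq_0_iff)
      then have "levi_min' J \<mu> {k. d k \<noteq> 0} \<subseteq> levi_min' J \<mu> {k. e k \<noteq> 0}"
        using levi_min_subset by (intro levi_min_mono) blast
      then show ?thesis using vd d(3) by blast
    qed
  qed
  then show "u *\<^sub>R x + v *\<^sub>R y \<in> attached J \<mu>"
    using eq ge unfolding attached_def by blast
qed

lemma attached_real: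
  assumes "\<mu> \<in> dom_chamber \<alpha>c J" "x \<in> attached J \<mu>" "j \<in> J"
  shows "scalar_product (\<alpha>c j) x \<in> \<real>"
  using assms pairing_comb_real
  by (auto simp: attached_def dom_chamber_iff scalar_product_diff intro!: Reals_diff)

text \<open>The step that produces the component condition. A downward reflection adds at most the node \<open>j\<close>. If \<open>j\<close> is new
  and inactive, then \<open>\<mu>\<close> pairs to zero with its coroot, so the positive pairing of \<open>x\<close> comes from a node of the
  support that is adjacent to \<open>j\<close>.\<close>

lemma attached_reflect:
  assumes mu: "\<mu> \<in> dom_chamber \<alpha>c J" and x: "x \<in> attached J \<mu>" and j: "j \<in> J" and pos: "0 \<le> h j x"
  shows "reflect j x \<in> attached J \<mu>"
proof (cases "h j x = 0")
  case True
  then show ?thesis using reflect_real[OF attached_real[OF mu x j]] x by simp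
next
  case False
  obtain c where c: "x = \<mu> - comb c" "\<And>k. 0 \<le> c k" "{k. c k \<noteq> 0} \<subseteq> levi_min' J \<mu> {k. c k \<noteq> 0}"
    using x by (auto simp: attached_def)
  define d where "d k = c k + (if k = j then h j x else 0)" for k
  have "comb d = comb c + h j x *\<^sub>R \<alpha> j"
    unfolding d_def comb_add comb_single ..
  then have eq: "reflect j x = \<mu> - comb d"
    using reflect_real[OF attached_real[OF mu x j]] by (simp add: c(1))
  have ge: "0 \<le> d k" for k using c(2) pos by (simp add: d_def)
  have supp: "{k. d k \<noteq> 0} = insert j {k. c k \<noteq> 0}"
    using False pos c(2) by (auto simp: d_def add_nonneg_eq_0_iff)
  have sub: "{k. c k \<noteq> 0} \<subseteq> levi_min' J \<mu> (insert j {k. c k \<noteq> 0})"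
    using levi_min_mono[of J \<mu> "{k. c k \<noteq> 0}" "insert j {k. c k \<noteq> 0}"]
      levi_min_subset[of J \<mu> "{k. c k \<noteq> 0}"] c(3) by blast
  have "j \<in> levi_min' J \<mu> (insert j {k. c k \<noteq> 0})"
  proof (cases "active \<alpha>c J \<mu> j \<or> c j \<noteq> 0")
    case True
    then show ?thesis using sub levi_min_active[of j _ J \<mu>] by blast
  next
    case no: False
    then have "h j \<mu> = 0" using mu j by (auto simp: active_iff dom_chamber_iff order_less_le)
    then have "h j (comb c) \<noteq> 0" using False by (simp add: c(1) h_diff)
    then obtain i where i: "c i \<noteq> 0" "A $ j $ i \<noteq> 0" using h_comb_zero by blast
    then have "(i, j) \<in> dynkin_edges A" using no zero_sym[of i j] by (auto simp: dynkin_edges_def)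
    then show ?thesis using i sub levi_min_step[of i J \<mu> _ j] by blast
  qed
  then show ?thesis using eq ge supp sub unfolding attached_def by fastforce
qed

lemma attached_act:
  assumes "\<mu> \<in> dom_chamber \<alpha>c J" "descending J js" "x \<in> attached J \<mu>" "x \<in> dominant J"
  shows "act js x \<in> attached J \<mu>"
  using assms(2)
  by (induction js) (use assms in \<open>auto intro: attached_reflect\<close>)

lemma attached_ray:
  assumes "\<mu> \<in> dom_chamber \<alpha>c J" "i \<notin> J" "0 \<le> r"
  shows "\<mu> - r *\<^sub>R \<alpha> i \<in> attached J \<mu>" "\<mu> - r *\<^sub>R \<alpha> i \<in> dominant J"
proof -
  have supp: "{k. (if k = i then r else 0) \<noteq> 0} = (if r = 0 then {} else {i})" by auto
  have "i \<in> levi_min' J \<mu> {i}" using assms by (intro levi_min_active) (auto simp: active_def)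
  then have "{k. (if k = i then r else 0) \<noteq> 0} \<subseteq> levi_min' J \<mu> {k. (if k = i then r else 0) \<noteq> 0}"
    unfolding supp by auto
  then show "\<mu> - r *\<^sub>R \<alpha> i \<in> attached J \<mu>"
    unfolding attached_def using assms(3) comb_single[of i r]
    by (intro CollectI exI[of _ "\<lambda>k. if k = i then r else 0"]) auto
  have "r * A $ j $ i \<le> 0" if "j \<in> J" for j
    using assms that off_diag[of j i] by (intro mult_nonneg_nonpos) auto
  then show "\<mu> - r *\<^sub>R \<alpha> i \<in> dominant J"
    using assms by (fastforce simp: dominant_def dom_chamber_iff h_diff h_scaleR)
qed

abbreviation polyhedron where "polyhedron J \<mu> \<equiv> weyl_P \<alpha> \<alpha>c \<mu> J"
abbreviation face where "face K J \<mu> \<equiv> wt_levi \<omega> K (weyl_P \<alpha> \<alpha>c \<mu> J)"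

lemma dom_chamber_dominant: "\<mu> \<in> dom_chamber \<alpha>c J \<Longrightarrow> \<mu> \<in> dominant J"
  by (auto simp: dom_chamber_iff dominant_def)

lemma weyl_group_descending:
  assumes "w \<in> weyl_group \<alpha> \<alpha>c J"
  obtains js where "descending J js" "w = act js"
proof -
  obtain ks where "set ks \<subseteq> J" "w = act ks" using assms unfolding weyl_group_words by blast
  moreover from this obtain js where "descending J js" "act js = act ks"
    using descending_word_exists by blast
  ultimately show ?thesis using that by simp
qed

text \<open>Treating the apex and the rays alike: if \<open>\<mu>\<close> is \<open>J\<close>-dominant, then so are all these points, since
  subtracting \<open>\<alpha>\<^sub>i\<close> with \<open>i \<notin> J\<close> does not decrease the pairings with the coroots of \<open>J\<close>.\<close>

definition generators :: "'i set \<Rightarrow> complex^'d \<Rightarrow> (complex^'d) set" where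
  "generators J \<mu> = (if J = UNIV then {\<mu>} else \<Union>i\<in>-J. {\<mu> - r *\<^sub>R \<alpha> i | r. r \<ge> 0})"

lemma weyl_P_eq_hull: "polyhedron J \<mu> = convex hull (\<Union>w\<in>weyl_group \<alpha> \<alpha>c J. w ` generators J \<mu>)"
proof -
  have "(\<lambda>w. w \<mu>) ` weyl_group \<alpha> \<alpha>c UNIV = (\<Union>w\<in>weyl_group \<alpha> \<alpha>c UNIV. w ` {\<mu>})" by blast
  then show ?thesis by (cases "J = UNIV") (simp_all add: weyl_P_def generators_def image_UN)
qed

text \<open>By convexity it is enough to follow a dominant generator along a descending word.\<close>

lemma weyl_P_attached:
  assumes "\<mu> \<in> dom_chamber \<alpha>c J"
  shows "polyhedron J \<mu> \<subseteq> attached J \<mu>"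
  unfolding weyl_P_eq_hull
proof (rule hull_minimal[where S = convex, OF _ convex_attached])
  have gen: "x \<in> attached J \<mu>" "x \<in> dominant J" if "x \<in> generators J \<mu>" for x
    using that attached_self attached_ray[OF assms] dom_chamber_dominant[OF assms]
    by (auto simp: generators_def split: if_splits)
  then show "(\<Union>w\<in>weyl_group \<alpha> \<alpha>c J. w ` generators J \<mu>) \<subseteq> attached J \<mu>"
    using attached_act[OF assms] by (auto elim!: weyl_group_descending)
qed

lemma id_in_weyl_group: "id \<in> weyl_group \<alpha> \<alpha>c J"
  unfolding weyl_group_words by (intro CollectI exI[of _ "[]"]) auto

lemma generators_subset: "generators J \<mu> \<subseteq> polyhedron J \<mu>"
proof -
  have "id ` generators J \<mu> \<subseteq> (\<Union>w\<in>weyl_group \<alpha> \<alpha>c J. w ` generators J \<mu>)"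
    using id_in_weyl_group by blast
  then show ?thesis unfolding weyl_P_eq_hull by (simp add: hull_subset subset_trans)
qed

lemma apex_mem: "\<mu> \<in> polyhedron J \<mu>"
proof -
  have "\<mu> \<in> generators J \<mu>"
  proof (cases "J = UNIV")
    case False
    then obtain i where "i \<notin> J" by blast
    moreover have "\<mu> \<in> {\<mu> - r *\<^sub>R \<alpha> i | r. r \<ge> 0}" by (intro CollectI exI[of _ 0]) simp
    ultimately show ?thesis using False unfolding generators_def by auto
  qed (simp add: generators_def)
  then show ?thesis using generators_subset by blast
qed

lemma ray_mem: "i \<notin> J \<Longrightarrow> 0 \<le> r \<Longrightarrow> \<mu> - r *\<^sub>R \<alpha> i \<in> polyhedron J \<mu>"
  using generators_subset by (fastforce simp: generators_def)

lemma linear_reflect: "linear (reflect j)"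
  by (intro linearI) (simp_all add: simple_reflection_def scalar_product_add scalar_product_scaleR
      vec_eq_iff algebra_simps scaleR_conv_of_real[where 'a = complex])

lemma linear_act: "linear (act js)"
proof (induction js)
  case Nil
  show ?case by (simp add: linear_id[unfolded id_def])
next
  case (Cons j js)
  then show ?case using linear_compose[OF Cons linear_reflect[of j]] by (simp add: o_def)
qed

lemma weyl_P_reflect:
  assumes "j \<in> J" "x \<in> polyhedron J \<mu>"
  shows "reflect j x \<in> polyhedron J \<mu>"
proof -
  let ?G = "\<Union>w\<in>weyl_group \<alpha> \<alpha>c J. w ` generators J \<mu>"
  have "reflect j \<circ> w \<in> weyl_group \<alpha> \<alpha>c J" if w: "w \<in> weyl_group \<alpha> \<alpha>c J" for w
  proof -
    obtain js where "set js \<subseteq> J" "w = act js" using w unfolding weyl_group_words by blast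
    then show ?thesis using assms(1) unfolding weyl_group_words by (intro CollectI exI[of _ "j # js"]) auto
  qed
  then have "reflect j ` ?G \<subseteq> ?G" by fastforce
  then have "convex hull (reflect j ` ?G) \<subseteq> convex hull ?G" by (rule hull_mono)
  then have "reflect j ` (convex hull ?G) \<subseteq> convex hull ?G"
    by (simp add: convex_hull_linear_image[OF linear_reflect])
  then show ?thesis using assms(2) unfolding weyl_P_eq_hull by blast
qed

lemma weyl_P_act: "set js \<subseteq> J \<Longrightarrow> x \<in> polyhedron J \<mu> \<Longrightarrow> act js x \<in> polyhedron J \<mu>"
  by (induction js) (auto intro: weyl_P_reflect)

lemma weyl_P_convex: "convex (polyhedron J \<mu>)"
  by (simp add: weyl_P_def)

lemma weyl_P_expand:
  assumes "\<mu> \<in> dom_chamber \<alpha>c J" "x \<in> polyhedron J \<mu>"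
  shows "x = \<mu> - comb (\<lambda>k. \<omega> k \<mu> - \<omega> k x)"
    and "\<omega> k x \<le> \<omega> k \<mu>"
    and "{k. \<omega> k x \<noteq> \<omega> k \<mu>} \<subseteq> levi_min' J \<mu> {k. \<omega> k x \<noteq> \<omega> k \<mu>}"
proof -
  obtain c where c: "x = \<mu> - comb c" "\<And>k. 0 \<le> c k" "{k. c k \<noteq> 0} \<subseteq> levi_min' J \<mu> {k. c k \<noteq> 0}"
    using weyl_P_attached[OF assms(1)] assms(2) unfolding attached_def by blast
  have eq: "\<omega> k \<mu> - \<omega> k x = c k" for k by (simp add: c(1) coweight_diff)
  then have supp: "{k. \<omega> k x \<noteq> \<omega> k \<mu>} = {k. c k \<noteq> 0}" by (metis eq_iff_diff_eq_0)
  show "x = \<mu> - comb (\<lambda>k. \<omega> k \<mu> - \<omega> k x)" unfolding eq by (rule c(1))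
  show "\<omega> k x \<le> \<omega> k \<mu>" using c(2)[of k] eq[of k] by linarith
  show "{k. \<omega> k x \<noteq> \<omega> k \<mu>} \<subseteq> levi_min' J \<mu> {k. \<omega> k x \<noteq> \<omega> k \<mu>}" unfolding supp by (rule c(3))
qed

lemma weyl_P_real:
  assumes "\<mu> \<in> dom_chamber \<alpha>c J" "x \<in> polyhedron J \<mu>" "j \<in> J"
  shows "reflect j x = x - h j x *\<^sub>R \<alpha> j"
  using assms weyl_P_attached attached_real reflect_real by blast

section \<open>Faces and their generic points\<close>

text \<open>The apex maximizes each coweight separately, so a maximizer of the sum maximizes every summand.\<close>

lemma face_iff:
  assumes "\<mu> \<in> dom_chamber \<alpha>c J"
  shows "x \<in> face K J \<mu> \<longleftrightarrow> x \<in> polyhedron J \<mu> \<and> (\<forall>k. k \<notin> K \<longrightarrow> \<omega> k x = \<omega> k \<mu>)"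
proof
  assume x: "x \<in> face K J \<mu>"
  then have xP: "x \<in> polyhedron J \<mu>" and max: "(\<Sum>i\<in>-K. \<omega> i \<mu>) \<le> (\<Sum>i\<in>-K. \<omega> i x)"
    using apex_mem by (auto simp: wt_levi_def)
  have le: "\<omega> i x \<le> \<omega> i \<mu>" for i using weyl_P_expand[OF assms xP] by blast
  have "\<omega> k x = \<omega> k \<mu>" if k: "k \<notin> K" for k
  proof (rule ccontr)
    assume "\<omega> k x \<noteq> \<omega> k \<mu>"
    then have "(\<Sum>i\<in>-K. \<omega> i x) < (\<Sum>i\<in>-K. \<omega> i \<mu>)"
      using le k by (intro sum_strict_mono_ex1) (auto simp: order_less_le)
    then show False using max by linarith
  qed
  then show "x \<in> polyhedron J \<mu> \<and> (\<forall>k. k \<notin> K \<longrightarrow> \<omega> k x = \<omega> k \<mu>)" using xP by blast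
next
  assume x: "x \<in> polyhedron J \<mu> \<and> (\<forall>k. k \<notin> K \<longrightarrow> \<omega> k x = \<omega> k \<mu>)"
  then have "(\<Sum>i\<in>-K. \<omega> i x) = (\<Sum>i\<in>-K. \<omega> i \<mu>)" by (intro sum.cong) auto
  moreover have "(\<Sum>i\<in>-K. \<omega> i y) \<le> (\<Sum>i\<in>-K. \<omega> i \<mu>)" if "y \<in> polyhedron J \<mu>" for y
    using weyl_P_expand(2)[OF assms that] by (intro sum_mono)
  ultimately show "x \<in> face K J \<mu>" using x by (auto simp: wt_levi_def)
qed

lemma apex_in_face: "\<mu> \<in> dom_chamber \<alpha>c J \<Longrightarrow> \<mu> \<in> face K J \<mu>"
  by (simp add: face_iff apex_mem)

lemma face_support:
  assumes "\<mu> \<in> dom_chamber \<alpha>c J" "x \<in> face K J \<mu>" "\<omega> k x \<noteq> \<omega> k \<mu>"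
  shows "k \<in> levi_min' J \<mu> K"
proof -
  have x: "x \<in> polyhedron J \<mu>" and supp: "{k. \<omega> k x \<noteq> \<omega> k \<mu>} \<subseteq> K"
    using assms(1,2) by (auto simp: face_iff)
  then have "levi_min' J \<mu> {k. \<omega> k x \<noteq> \<omega> k \<mu>} \<subseteq> levi_min' J \<mu> K"
    using levi_min_subset by (intro levi_min_mono) blast
  then show ?thesis using weyl_P_expand(3)[OF assms(1) x] assms(3) by blast
qed

lemma h_expand_ge:
  assumes "\<mu> \<in> dom_chamber \<alpha>c J" "x \<in> polyhedron J \<mu>" "\<omega> j x = \<omega> j \<mu>"
  shows "h j \<mu> \<le> h j x"
    and "\<omega> i x \<noteq> \<omega> i \<mu> \<Longrightarrow> (i, j) \<in> dynkin_edges A \<Longrightarrow> h j \<mu> < h j x"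
proof -
  define c where "c k = \<omega> k \<mu> - \<omega> k x" for k
  have x: "x = \<mu> - comb c" and c: "0 \<le> c k" "c k \<noteq> 0 \<longleftrightarrow> \<omega> k x \<noteq> \<omega> k \<mu>" "c j = 0" for k
    using weyl_P_expand[OF assms(1,2)] assms(3) by (auto simp: c_def[abs_def])
  have hx: "h j x = h j \<mu> - h j (comb c)" by (simp only: x h_diff)
  show "h j \<mu> \<le> h j x"
    using h_comb_le[of c j] c unfolding hx by simp
  show "h j \<mu> < h j x" if "\<omega> i x \<noteq> \<omega> i \<mu>" "(i, j) \<in> dynkin_edges A"
    using h_comb_neg[of c j i] c that unfolding hx by simp
qed

text \<open>Positivity of the pairings on the support keeps the construction going, and it is what the stabilizer
  argument needs in the end.\<close>

definition generic_on :: "'i set \<Rightarrow> complex^'d \<Rightarrow> 'i set \<Rightarrow> complex^'d \<Rightarrow> bool" where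
  "generic_on J \<mu> T x \<longleftrightarrow> x \<in> polyhedron J \<mu> \<and> (\<forall>k. \<omega> k x \<noteq> \<omega> k \<mu> \<longleftrightarrow> k \<in> T) \<and> (\<forall>j\<in>T \<inter> J. 0 < h j x)"

text \<open>For \<open>k \<in> J\<close> the pairing of \<open>x\<close> with the coroot of \<open>k\<close> is positive, by activity or by adjacency to the
  support. Moving a quarter of the way to the mirror image halves this pairing and does not decrease any other.
  For \<open>k \<notin> J\<close> the midpoint with a point on the ray along \<open>-\<alpha>\<^sub>k\<close> has the right support and keeps
  the other pairings positive.\<close>

lemma generic_on_extend:
  assumes mu: "\<mu> \<in> dom_chamber \<alpha>c J" and x: "generic_on J \<mu> T x" and k: "k \<notin> T"
    and new: "active \<alpha>c J \<mu> k \<or> (\<exists>i\<in>T. (i, k) \<in> dynkin_edges A)"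
  shows "\<exists>y. generic_on J \<mu> (insert k T) y"
proof -
  have xP: "x \<in> polyhedron J \<mu>" and supp: "\<And>k. \<omega> k x \<noteq> \<omega> k \<mu> \<longleftrightarrow> k \<in> T" and pos: "\<And>j. j \<in> T \<inter> J \<Longrightarrow> 0 < h j x"
    using x by (auto simp: generic_on_def)
  have le: "\<omega> i x \<le> \<omega> i \<mu>" for i using weyl_P_expand[OF mu xP] by blast
  have off: "A $ j $ k \<le> 0" if "j \<in> T" for j using off_diag[of j k] k that by blast
  show ?thesis
  proof (cases "k \<in> J")
    case False
    define y where "y = (1/2) *\<^sub>R x + (1/2) *\<^sub>R (\<mu> - 1 *\<^sub>R \<alpha> k)"
    have "y \<in> polyhedron J \<mu>"
      unfolding y_def by (intro convexD[OF weyl_P_convex] xP ray_mem False) auto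
    moreover have wy: "\<omega> i y = (\<omega> i x + \<omega> i \<mu> - (if i = k then 1 else 0)) / 2" for i
      by (simp add: y_def coweight_add coweight_diff coweight_scaleR field_simps)
    have "\<omega> i y \<noteq> \<omega> i \<mu> \<longleftrightarrow> i \<in> insert k T" for i
      using supp[of i] le[of i] unfolding wy by (cases "i = k") auto
    moreover have "0 < h j y" if j: "j \<in> insert k T \<inter> J" for j
    proof -
      have jT: "j \<in> T" "j \<in> J" using j False by auto
      have "0 \<le> h j \<mu>" using mu jT by (auto simp: dom_chamber_iff)
      moreover have "h j y = (h j x + h j \<mu> - A $ j $ k) / 2"
        by (simp add: y_def h_add h_diff h_scaleR field_simps)
      ultimately show ?thesis using pos[of j] off[of j] jT by simp
    qed
    ultimately show ?thesis unfolding generic_on_def by blast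
  next
    case True
    have eq: "\<omega> k x = \<omega> k \<mu>" using supp[of k] k by blast
    have hk: "0 < h k x"
      using new h_expand_ge[OF mu xP eq] supp mu True by (fastforce simp: active_iff dom_chamber_iff)
    define y where "y = (3/4) *\<^sub>R x + (1/4) *\<^sub>R reflect k x"
    have "y \<in> polyhedron J \<mu>"
      unfolding y_def by (intro convexD[OF weyl_P_convex] xP weyl_P_reflect True) auto
    moreover have wy: "\<omega> i y = \<omega> i x - (if i = k then h k x / 4 else 0)" for i
      by (simp add: y_def weyl_P_real[OF mu xP True] coweight_add coweight_diff coweight_scaleR field_simps)
    have "\<omega> i y \<noteq> \<omega> i \<mu> \<longleftrightarrow> i \<in> insert k T" for i
      using supp[of i] hk eq unfolding wy by (cases "i = k") auto
    moreover have "0 < h j y" if j: "j \<in> insert k T \<inter> J" for j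
    proof -
      have hy: "h j y = h j x - A $ j $ k * h k x / 4"
        by (simp add: y_def h_add h_reflect h_scaleR field_simps)
      show ?thesis
      proof (cases "j = k")
        case True
        then show ?thesis using hk hy by simp
      next
        case False
        then have "A $ j $ k * h k x \<le> 0" using off[of j] j hk by (intro mult_nonpos_nonneg) auto
        then show ?thesis using pos[of j] j False unfolding hy by simp
      qed
    qed
    ultimately show ?thesis unfolding generic_on_def by blast
  qed
qed

text \<open>A maximal support contains every active node and every neighbour inside \<open>K\<close>, so it is all of
  \<open>K\<^sub>m\<^sub>i\<^sub>n\<close>.\<close>

lemma generic_point:
  assumes mu: "\<mu> \<in> dom_chamber \<alpha>c J"
  obtains x where "generic_on J \<mu> (levi_min' J \<mu> K) x"
proof -
  define \<T> where "\<T> = {T. T \<subseteq> levi_min' J \<mu> K \<and> (\<exists>x. generic_on J \<mu> T x)}"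
  have "generic_on J \<mu> {} \<mu>" by (simp add: generic_on_def apex_mem)
  then have "\<T> \<noteq> {}" by (auto simp: \<T>_def)
  then obtain T where T: "T \<in> \<T>" and max: "\<And>T'. T' \<in> \<T> \<Longrightarrow> T \<subseteq> T' \<Longrightarrow> T = T'"
    using finite_has_maximal[of \<T>] by auto
  obtain x where sub: "T \<subseteq> levi_min' J \<mu> K" and x: "generic_on J \<mu> T x"
    using T by (auto simp: \<T>_def)
  have grow: "k \<in> T" if "k \<in> levi_min' J \<mu> K" "active \<alpha>c J \<mu> k \<or> (\<exists>i\<in>T. (i, k) \<in> dynkin_edges A)" for k
  proof (rule ccontr)
    assume "k \<notin> T"
    then have "insert k T \<in> \<T>" using generic_on_extend[OF mu x] that sub by (auto simp: \<T>_def)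
    then show False using max \<open>k \<notin> T\<close> by blast
  qed
  have "levi_min' J \<mu> K \<subseteq> T"
  proof (rule levi_min_least)
    fix k assume "k \<in> K" "active \<alpha>c J \<mu> k"
    then show "k \<in> T" using grow levi_min_active by blast
  next
    fix j k assume "j \<in> T" "k \<in> K" "(j, k) \<in> dynkin_edges A"
    then show "k \<in> T" using grow levi_min_step[of j J \<mu> K k] sub by blast
  qed
  then show ?thesis using x sub that by auto
qed

lemma generic_in_face:
  assumes "\<mu> \<in> dom_chamber \<alpha>c J" "generic_on J \<mu> (levi_min' J \<mu> K) x"
  shows "x \<in> face K J \<mu>"
  using assms levi_min_subset[of J \<mu> K] by (auto simp: face_iff generic_on_def)

lemma face_subset_iff:
  assumes mu: "\<mu> \<in> dom_chamber \<alpha>c J"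
  shows "face K J \<mu> \<subseteq> face L J \<mu> \<longleftrightarrow> levi_min' J \<mu> K \<subseteq> L"
proof
  assume sub: "face K J \<mu> \<subseteq> face L J \<mu>"
  obtain x where x: "generic_on J \<mu> (levi_min' J \<mu> K) x" using generic_point[OF mu] .
  then have "x \<in> face L J \<mu>" using generic_in_face[OF mu] sub by blast
  then show "levi_min' J \<mu> K \<subseteq> L" using x by (auto simp: face_iff[OF mu] generic_on_def)
next
  assume sub: "levi_min' J \<mu> K \<subseteq> L"
  show "face K J \<mu> \<subseteq> face L J \<mu>"
  proof
    fix x assume x: "x \<in> face K J \<mu>"
    then have "\<omega> k x = \<omega> k \<mu>" if "k \<notin> L" for k
      using face_support[OF mu x] sub that by blast
    then show "x \<in> face L J \<mu>" using x by (simp add: face_iff[OF mu])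
  qed
qed

text \<open>Both sides say that \<open>K\<close> and \<open>L\<close> have the same minimal set: the nodes of \<open>L\<close> that remain are then
  inactive and not adjacent to it, which is the description of \<open>K\<^sub>d\<close>.\<close>

lemma levi_min_subset_iff_subset_levi_max:
  assumes "\<mu> \<in> dom_chamber \<alpha>c J" and KL: "levi_min' J \<mu> K \<subseteq> L"
  shows "levi_min' J \<mu> L \<subseteq> K \<longleftrightarrow> L \<subseteq> levi_max A \<alpha>c J \<mu> K"
proof
  assume LK: "levi_min' J \<mu> L \<subseteq> K"
  have eq: "levi_min' J \<mu> L = levi_min' J \<mu> K"
    using levi_min_mono[OF LK] levi_min_mono[OF KL] by blast
  show "L \<subseteq> levi_max A \<alpha>c J \<mu> K"
  proof
    fix j assume j: "j \<in> L"
    show "j \<in> levi_max A \<alpha>c J \<mu> K"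
    proof (cases "j \<in> levi_min' J \<mu> K")
      case False
      then have "\<not> active \<alpha>c J \<mu> j" using levi_min_active[OF j] eq by blast
      then have "j \<in> J" "scalar_product (\<alpha>c j) \<mu> = 0"
        using assms pairing_zero_iff[OF assms(1)] by (auto simp: active_iff dom_chamber_iff order_less_le)
      moreover have "(j, k) \<notin> dynkin_edges A" if "k \<in> levi_min' J \<mu> K" for k
        using False levi_min_step[of k J \<mu> L j] that eq j edge_sym[of j k] by blast
      ultimately show ?thesis by (auto simp: levi_max_def levi_d_def)
    qed (simp add: levi_max_def)
  qed
next
  assume LK: "L \<subseteq> levi_max A \<alpha>c J \<mu> K"
  have "levi_min' J \<mu> L \<subseteq> levi_min' J \<mu> K"
  proof (rule levi_min_least)
    fix k assume "k \<in> L" "active \<alpha>c J \<mu> k"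
    then show "k \<in> levi_min' J \<mu> K"
      using LK assms by (auto simp: levi_max_def levi_d_def active_iff h_def)
  next
    fix j k assume "j \<in> levi_min' J \<mu> K" "k \<in> L" "(j, k) \<in> dynkin_edges A"
    then show "k \<in> levi_min' J \<mu> K"
      using LK edge_sym[of j k] by (auto simp: levi_max_def levi_d_def)
  qed
  then show "levi_min' J \<mu> L \<subseteq> K" using levi_min_subset by blast
qed

section \<open>Stabilizers of faces\<close>

text \<open>A letter of \<open>K\<^sub>m\<^sub>i\<^sub>n\<close> moves points along a root of \<open>K\<close>; a letter of \<open>K\<^sub>d\<close> is orthogonal to \<open>\<mu>\<close> and
  to the roots of \<open>K\<^sub>m\<^sub>i\<^sub>n\<close>, so it fixes the face pointwise.\<close>

lemma face_reflect:
  assumes mu: "\<mu> \<in> dom_chamber \<alpha>c J" and j: "j \<in> levi_max A \<alpha>c J \<mu> K \<inter> J" and x: "x \<in> face K J \<mu>"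
  shows "reflect j x \<in> face K J \<mu>"
proof -
  have xP: "x \<in> polyhedron J \<mu>" using x mu by (simp add: face_iff)
  have rx: "reflect j x = x - h j x *\<^sub>R \<alpha> j" using weyl_P_real[OF mu xP] j by blast
  show ?thesis
  proof (cases "j \<in> levi_min' J \<mu> K")
    case True
    then have "j \<in> K" using levi_min_subset by blast
    then have "\<omega> k (reflect j x) = \<omega> k x" if "k \<notin> K" for k
      using that by (auto simp: rx coweight_diff coweight_scaleR)
    then show ?thesis using x weyl_P_reflect[OF _ xP, of j] j by (auto simp: face_iff[OF mu])
  next
    case False
    then have jd: "j \<in> levi_d A \<alpha>c J \<mu> K" using j by (auto simp: levi_max_def)
    have "A $ j $ k = 0" if "\<omega> k \<mu> - \<omega> k x \<noteq> 0" for k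
      using levi_d_orthogonal_levi_min[OF mu jd face_support[OF mu x]] that by simp
    then have "h j (comb (\<lambda>k. \<omega> k \<mu> - \<omega> k x)) = 0" by (rule h_comb_zero)
    moreover have "h j \<mu> = 0" using jd by (simp add: levi_d_def h_def)
    ultimately have "h j x = 0"
      using weyl_P_expand(1)[OF mu xP] h_diff by (metis diff_zero)
    then show ?thesis using rx x by simp
  qed
qed

text \<open>All steps of a descending word subtract nonnegative multiples of roots. Since the total has no part outside
  \<open>K\<close>, neither has any step. The first letter \<open>j\<close> outside \<open>M\<close> to act would act on \<open>x\<close> minus roots other than
  \<open>\<alpha>\<^sub>j\<close>, which only enlarges the positive pairing of \<open>x\<close>, and so its step would not vanish.\<close>

lemma descending_letters:
  assumes mu: "\<mu> \<in> dom_chamber \<alpha>c J" and x: "x \<in> polyhedron J \<mu>" "x \<in> dominant J"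
    and M: "K \<subseteq> M" "\<And>j. j \<in> J \<Longrightarrow> j \<notin> M \<Longrightarrow> 0 < h j x"
    and js: "descending J js" "\<And>k. k \<notin> K \<Longrightarrow> \<omega> k (act js x) = \<omega> k x"
  shows "set js \<subseteq> M"
proof -
  have "(\<exists>c. act js x = x - comb c \<and> (\<forall>k. 0 \<le> c k)) \<and>
    ((\<forall>k. k \<notin> K \<longrightarrow> \<omega> k (act js x) = \<omega> k x) \<longrightarrow> set js \<subseteq> M)"
    using js(1)
  proof (induction js)
    case Nil
    show ?case by (auto intro: exI[of _ "\<lambda>_. 0"])
  next
    case (Cons j js)
    let ?y = "act js x"
    obtain c where c: "?y = x - comb c" "\<And>k. 0 \<le> c k"
      and IH: "(\<forall>k. k \<notin> K \<longrightarrow> \<omega> k ?y = \<omega> k x) \<Longrightarrow> set js \<subseteq> M"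
      using Cons by auto
    have j: "j \<in> J" and hy: "0 \<le> h j ?y" and jsJ: "set js \<subseteq> J"
      using Cons.prems x descending_set[of J js] by auto
    have ry: "reflect j ?y = ?y - h j ?y *\<^sub>R \<alpha> j"
      using weyl_P_real[OF mu weyl_P_act[OF jsJ x(1)] j] .
    define d where "d k = c k + (if k = j then h j ?y else 0)" for k
    have "comb d = comb c + h j ?y *\<^sub>R \<alpha> j"
      unfolding d_def comb_add comb_single ..
    then have eq: "act (j # js) x = x - comb d" by (simp add: ry) (simp add: c(1))
    have ge: "0 \<le> d k" for k using c(2) hy by (simp add: d_def)
    have "set (j # js) \<subseteq> M" if fixed: "\<forall>k. k \<notin> K \<longrightarrow> \<omega> k (act (j # js) x) = \<omega> k x"
    proof -
      have d0: "d k = 0" if "k \<notin> K" for k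
        using fixed that unfolding eq by (simp add: coweight_diff)
      have c0: "c k = 0" if "k \<notin> K" for k
        using d0[OF that] c(2)[of k] hy by (auto simp: d_def split: if_splits)
      have "set js \<subseteq> M" using IH c0 by (simp add: c(1) coweight_diff)
      moreover have "j \<in> M"
      proof (rule ccontr)
        assume "j \<notin> M"
        then have jK: "j \<notin> K" using M by blast
        have "h j ?y \<ge> h j x"
          using h_comb_le[of c j] c(2) c0[OF jK] by (simp add: c(1) h_diff)
        then show False using M(2)[OF j \<open>j \<notin> M\<close>] d0[OF jK] c0[OF jK] by (simp add: d_def)
      qed
      ultimately show ?thesis by simp
    qed
    then show ?case using eq ge by blast
  qed
  then show ?thesis using js(2) by blast
qed

text \<open>Apply the preceding lemma to a generic point. For \<open>j \<in> J\<close> outside its support the pairing is at least that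
  of \<open>\<mu>\<close>, and strictly larger if \<open>j\<close> is adjacent to \<open>K\<^sub>m\<^sub>i\<^sub>n\<close>; it vanishes only for \<open>j \<in> K\<^sub>d\<close>.\<close>

lemma face_stabilizer_subset:
  assumes mu: "\<mu> \<in> dom_chamber \<alpha>c J" and w: "w \<in> weyl_group \<alpha> \<alpha>c J"
    and stab: "w ` face K J \<mu> \<subseteq> face K J \<mu>"
  shows "w \<in> weyl_group \<alpha> \<alpha>c (levi_max A \<alpha>c J \<mu> K \<inter> J)"
proof -
  let ?M = "levi_min' J \<mu> K"
  obtain js where js: "descending J js" "w = act js" using weyl_group_descending[OF w] .
  obtain x where x: "generic_on J \<mu> ?M x" using generic_point[OF mu] .
  then have xP: "x \<in> polyhedron J \<mu>" and supp: "\<And>k. \<omega> k x \<noteq> \<omega> k \<mu> \<longleftrightarrow> k \<in> ?M"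
    and pos: "\<And>j. j \<in> ?M \<inter> J \<Longrightarrow> 0 < h j x" by (auto simp: generic_on_def)
  have mu_pos: "0 \<le> h j \<mu>" if "j \<in> J" for j using mu that by (auto simp: dom_chamber_iff)
  have off: "0 \<le> h j x \<and> (j \<notin> levi_max A \<alpha>c J \<mu> K \<longrightarrow> 0 < h j x)" if j: "j \<in> J" "j \<notin> ?M" for j
  proof -
    have eq: "\<omega> j x = \<omega> j \<mu>" using supp j by blast
    have "0 < h j x" if no: "j \<notin> levi_max A \<alpha>c J \<mu> K"
    proof (cases "h j \<mu> = 0")
      case True
      then obtain k where "k \<in> ?M" "(k, j) \<in> dynkin_edges A"
        using no j pairing_zero_iff[OF mu] edge_sym by (auto simp: levi_max_def levi_d_def)
      then show ?thesis using h_expand_ge(2)[OF mu xP eq, of k] supp mu_pos[OF j(1)] by auto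
    next
      case False
      then show ?thesis using h_expand_ge(1)[OF mu xP eq] mu_pos[OF j(1)] by linarith
    qed
    then show ?thesis using h_expand_ge(1)[OF mu xP eq] mu_pos[OF j(1)] by linarith
  qed
  have "0 \<le> h j x" if "j \<in> J" for j using off[OF that] pos[of j] that by (cases "j \<in> ?M") auto
  then have dom: "x \<in> dominant J" by (auto simp: dominant_def)
  have "w x \<in> face K J \<mu>" using stab generic_in_face[OF mu x] by blast
  then have fixed: "\<omega> k (act js x) = \<omega> k x" if "k \<notin> ?M" for k
    using face_support[OF mu, of "w x" K k] supp[of k] that js(2) by auto
  have "set js \<subseteq> levi_max A \<alpha>c J \<mu> K"
  proof (rule descending_letters[OF mu xP dom _ _ js(1) fixed])
    show "?M \<subseteq> levi_max A \<alpha>c J \<mu> K" by (simp add: levi_max_def)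
    show "0 < h j x" if "j \<in> J" "j \<notin> levi_max A \<alpha>c J \<mu> K" for j
      using off[of j] that by (auto simp: levi_max_def)
  qed
  then show ?thesis using js descending_set[OF js(1)] unfolding weyl_group_words by blast
qed

lemma weyl_group_inverse:
  assumes "w \<in> weyl_group \<alpha> \<alpha>c K"
  obtains v where "v \<in> weyl_group \<alpha> \<alpha>c K" "\<And>x. w (v x) = x"
proof -
  obtain js where js: "set js \<subseteq> K" "w = act js" using assms unfolding weyl_group_words by blast
  have "act js (act (rev js) x) = x" for x by (induction js arbitrary: x) auto
  then show ?thesis using js that[of "act (rev js)"] unfolding weyl_group_words by (metis (mono_tags, lifting) mem_Collect_eq set_rev)
qed

lemma weyl_group_levi_max_stabilizes_face:
  assumes "\<mu> \<in> dom_chamber \<alpha>c J" "w \<in> weyl_group \<alpha> \<alpha>c (levi_max A \<alpha>c J \<mu> K \<inter> J)"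
  shows "w ` face K J \<mu> \<subseteq> face K J \<mu>"
proof -
  obtain js where js: "set js \<subseteq> levi_max A \<alpha>c J \<mu> K \<inter> J" "w = act js"
    using assms(2) unfolding weyl_group_words by blast
  have "act js x \<in> face K J \<mu>" if "x \<in> face K J \<mu>" for x
    using js(1) by (induction js) (use that face_reflect[OF assms(1)] in auto)
  then show ?thesis using js(2) by blast
qed

section \<open>Families of Weyl polyhedra\<close>

text \<open>The combination of the two apexes lies in the polyhedron of \<open>c\<close>, hence below \<open>c\<close>; and \<open>c\<close> is a combination of
  points below the two apexes, hence below their combination.\<close>

lemma apex_combination:
  assumes dom: "a \<in> dom_chamber \<alpha>c J" "b \<in> dom_chamber \<alpha>c J" "c \<in> dom_chamber \<alpha>c J"
    and t: "0 \<le> t" "t \<le> 1"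
    and comb: "{t *\<^sub>R x + (1 - t) *\<^sub>R y | x y. x \<in> polyhedron J a \<and> y \<in> polyhedron J b} = polyhedron J c"
  shows "c = t *\<^sub>R a + (1 - t) *\<^sub>R b"
proof -
  define m where "m = t *\<^sub>R a + (1 - t) *\<^sub>R b"
  have m: "m \<in> polyhedron J c" unfolding comb[symmetric] m_def using apex_mem by blast
  obtain x y where xy: "c = t *\<^sub>R x + (1 - t) *\<^sub>R y" "x \<in> polyhedron J a" "y \<in> polyhedron J b"
    using apex_mem[of c J] unfolding comb[symmetric] by blast
  have "\<omega> k m = \<omega> k c" for k
  proof (rule antisym)
    show "\<omega> k m \<le> \<omega> k c" using weyl_P_expand(2)[OF dom(3) m] .
    have "t * \<omega> k x + (1 - t) * \<omega> k y \<le> t * \<omega> k a + (1 - t) * \<omega> k b"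
      using t weyl_P_expand(2)[OF dom(1) xy(2)] weyl_P_expand(2)[OF dom(2) xy(3)]
      by (intro add_mono mult_left_mono) auto
    then show "\<omega> k c \<le> \<omega> k m" by (simp add: xy(1) m_def coweight_add coweight_scaleR)
  qed
  then have "m = c" using weyl_P_expand(1)[OF dom(3) m] by simp
  then show ?thesis by (simp add: m_def)
qed

end

text \<open>A family of Weyl polyhedra over a convex base, presented by the apexes of its fibers.\<close>

locale polyhedron_family = root_system A \<alpha> \<alpha>c \<omega>
  for A :: "int^'i^'i" and \<alpha> \<alpha>c :: "'i::finite \<Rightarrow> complex^'d" and \<omega> :: "'i \<Rightarrow> complex^'d \<Rightarrow> real" +
  fixes J :: "'i set" and S :: "'s::euclidean_space set" and lam :: "'s \<Rightarrow> complex^'d"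
  assumes lam_dom: "u \<in> S \<Longrightarrow> lam u \<in> dom_chamber \<alpha>c J"
    and family: "\<lbrakk>u \<in> S; v \<in> S; 0 \<le> t; t \<le> 1\<rbrakk> \<Longrightarrow> t *\<^sub>R u + (1 - t) *\<^sub>R v \<in> S \<and>
      {t *\<^sub>R x + (1 - t) *\<^sub>R y | x y. x \<in> polyhedron J (lam u) \<and> y \<in> polyhedron J (lam v)} =
      polyhedron J (lam (t *\<^sub>R u + (1 - t) *\<^sub>R v))"
begin

abbreviation face_bundle where "face_bundle \<equiv> wt_levi_face \<alpha> \<alpha>c \<omega> J lam"

lemma face_bundle_iff: "(u, x) \<in> face_bundle K F \<longleftrightarrow> u \<in> F \<and> x \<in> face K J (lam u)"
  by (simp add: wt_levi_face_def)

lemma base_subset: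
  assumes "F \<subseteq> S" "map_prod id w ` face_bundle K F \<subseteq> face_bundle L G"
  shows "F \<subseteq> G"
proof
  fix u assume u: "u \<in> F"
  then have "(u, lam u) \<in> face_bundle K F"
    using assms(1) lam_dom by (auto simp: face_bundle_iff intro!: apex_in_face)
  then have "(u, w (lam u)) \<in> face_bundle L G" using assms(2) by force
  then show "u \<in> G" by (simp add: face_bundle_iff)
qed

text \<open>For a point \<open>u\<close> of \<open>F\<close> extend the segment from \<open>u\<close> beyond \<open>s\<close> to some \<open>v \<in> F\<close>. Mixing a point of the face over
  \<open>u\<close> with the apex over \<open>v\<close> gives a point of the face over \<open>s\<close>. If its image under \<open>w\<close> is extremal for a coweight, then
  so is the image of the point over \<open>u\<close>, because neither image exceeds its own apex and the weight of \<open>u\<close> is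
  positive.\<close>

lemma translated_face_bundle_subset_iff:
  assumes F: "F \<subseteq> S" "convex F" and s: "s \<in> rel_interior F" and w: "w \<in> weyl_group \<alpha> \<alpha>c J"
  shows "map_prod id w ` face_bundle K F \<subseteq> face_bundle L G \<longleftrightarrow>
    F \<subseteq> G \<and> w ` face K J (lam s) \<subseteq> face L J (lam s)"
proof
  assume sub: "map_prod id w ` face_bundle K F \<subseteq> face_bundle L G"
  have sF: "s \<in> F" using s rel_interior_subset by blast
  have "w x \<in> face L J (lam s)" if "x \<in> face K J (lam s)" for x
  proof -
    have "(s, x) \<in> face_bundle K F" using that sF by (simp add: face_bundle_iff)
    then have "(s, w x) \<in> face_bundle L G" using sub by force
    then show ?thesis by (simp add: face_bundle_iff)
  qed
  then show "F \<subseteq> G \<and> w ` face K J (lam s) \<subseteq> face L J (lam s)"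
    using base_subset[OF F(1) sub] by blast
next
  assume R: "F \<subseteq> G \<and> w ` face K J (lam s) \<subseteq> face L J (lam s)"
  have sS: "s \<in> S" using s rel_interior_subset F by blast
  obtain js where js: "set js \<subseteq> J" "w = act js" using w unfolding weyl_group_words by blast
  have "w x \<in> face L J (lam u)" if u: "u \<in> F" and x: "x \<in> face K J (lam u)" for u x
  proof -
    obtain e where e: "e > 1" "(1 - e) *\<^sub>R u + e *\<^sub>R s \<in> F"
      using convex_rel_interior_iff[of F s] F s u by blast
    define v where "v = (1 - e) *\<^sub>R u + e *\<^sub>R s"
    define t where "t = 1 - 1 / e"
    have t: "0 < t" "t \<le> 1" using e by (auto simp: t_def)
    have "(1 / e) *\<^sub>R v = (1 / e - 1) *\<^sub>R u + s"
      using e by (simp add: v_def scaleR_add_right diff_divide_distrib)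
    then have s_eq: "s = t *\<^sub>R u + (1 - t) *\<^sub>R v"
      by (simp add: t_def algebra_simps)
    have uS: "u \<in> S" and vS: "v \<in> S" using u e F by (auto simp: v_def)
    note dom = lam_dom[OF uS] lam_dom[OF vS] lam_dom[OF sS]
    have fam: "{t *\<^sub>R x + (1 - t) *\<^sub>R y | x y. x \<in> polyhedron J (lam u) \<and> y \<in> polyhedron J (lam v)} = polyhedron J (lam s)"
      using family[OF uS vS, of t] t s_eq by simp
    have lam_s: "lam s = t *\<^sub>R lam u + (1 - t) *\<^sub>R lam v"
      using apex_combination[OF dom _ _ fam] t by simp
    define y where "y = lam v"
    have xP: "x \<in> polyhedron J (lam u)" and yP: "y \<in> polyhedron J (lam v)"
      using x dom apex_mem by (auto simp: face_iff y_def)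
    let ?z = "t *\<^sub>R x + (1 - t) *\<^sub>R y"
    have "?z \<in> polyhedron J (lam s)" using xP yP unfolding fam[symmetric] by blast
    moreover have "\<omega> k ?z = \<omega> k (lam s)" if "k \<notin> K" for k
      using x dom that by (simp add: lam_s y_def face_iff coweight_add coweight_scaleR)
    ultimately have "?z \<in> face K J (lam s)" using dom by (simp add: face_iff)
    then have wz: "w ?z \<in> face L J (lam s)" using R by blast
    have w_eq: "w ?z = t *\<^sub>R w x + (1 - t) *\<^sub>R w y"
      using linear_act[of js] js by (simp add: linear_add linear_scale)
    have wxP: "w x \<in> polyhedron J (lam u)" and wyP: "w y \<in> polyhedron J (lam v)"
      using weyl_P_act js xP yP by auto
    have "\<omega> k (w x) = \<omega> k (lam u)" if "k \<notin> L" for k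
    proof -
      have "t * \<omega> k (w x) + (1 - t) * \<omega> k (w y) = t * \<omega> k (lam u) + (1 - t) * \<omega> k (lam v)"
        using wz that dom(3) by (simp add: face_iff w_eq lam_s coweight_add coweight_scaleR)
      moreover have "(1 - t) * \<omega> k (w y) \<le> (1 - t) * \<omega> k (lam v)"
        using t weyl_P_expand(2)[OF dom(2) wyP] by (intro mult_left_mono) auto
      ultimately have "t * \<omega> k (lam u) \<le> t * \<omega> k (w x)" by linarith
      then show ?thesis using t weyl_P_expand(2)[OF dom(1) wxP, of k] by simp
    qed
    then show ?thesis using wxP dom by (simp add: face_iff)
  qed
  then show "map_prod id w ` face_bundle K F \<subseteq> face_bundle L G"
    using R by (auto simp: face_bundle_iff)
qed

lemma face_bundle_subset_iff:
  assumes F: "F \<subseteq> S" "convex F" and s: "s \<in> rel_interior F"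
  shows "face_bundle K F \<subseteq> face_bundle L G \<longleftrightarrow> F \<subseteq> G \<and> levi_min' J (lam s) K \<subseteq> L"
proof -
  have "s \<in> S" using s F rel_interior_subset by blast
  then show ?thesis
    using translated_face_bundle_subset_iff[OF F s id_in_weyl_group, of K L G] face_subset_iff[OF lam_dom]
    by (simp add: map_prod.id)
qed

lemma face_bundle_eq_iff:
  assumes F: "F \<subseteq> S" "convex F" and G: "G \<subseteq> S" and s: "s \<in> rel_interior F"
  shows "face_bundle K F = face_bundle L G \<longleftrightarrow>
    F = G \<and> levi_min' J (lam s) K \<subseteq> L \<and> L \<subseteq> levi_max A \<alpha>c J (lam s) K"
proof -
  have dom: "lam s \<in> dom_chamber \<alpha>c J" using s F rel_interior_subset lam_dom by blast
  have base: "F = G" if "face_bundle K F = face_bundle L G"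
  proof (rule antisym)
    show "F \<subseteq> G" using base_subset[OF F(1), of id K L G] that by (simp add: map_prod.id)
    show "G \<subseteq> F" using base_subset[OF G, of id L K F] that by (simp add: map_prod.id)
  qed
  have inclusion: "face_bundle K' F \<subseteq> face_bundle L' F \<longleftrightarrow> levi_min' J (lam s) K' \<subseteq> L'" for K' L'
    using face_bundle_subset_iff[OF F s, of K' L' F] by simp
  have "face_bundle K F = face_bundle L F \<longleftrightarrow>
      levi_min' J (lam s) K \<subseteq> L \<and> L \<subseteq> levi_max A \<alpha>c J (lam s) K"
    unfolding set_eq_subset[of "face_bundle K F"] inclusion
    using levi_min_subset_iff_subset_levi_max[OF dom, of K L] by (rule conj_cong[OF HOL.refl])
  then show ?thesis using base by (cases "F = G") (simp, blast)
qed

lemma face_bundle_stabilizer: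
  assumes F: "F \<subseteq> S" "convex F" and s: "s \<in> rel_interior F"
  shows "{w \<in> weyl_group \<alpha> \<alpha>c J. map_prod id w ` face_bundle K F = face_bundle K F} =
    weyl_group \<alpha> \<alpha>c (levi_max A \<alpha>c J (lam s) K \<inter> J)" (is "?stab = ?W")
proof
  have dom: "lam s \<in> dom_chamber \<alpha>c J" using s F rel_interior_subset lam_dom by blast
  show "?stab \<subseteq> ?W"
  proof
    fix w assume "w \<in> ?stab"
    then have "w \<in> weyl_group \<alpha> \<alpha>c J" "map_prod id w ` face_bundle K F \<subseteq> face_bundle K F" by auto
    then show "w \<in> ?W"
      using translated_face_bundle_subset_iff[OF F s, of w K K F] face_stabilizer_subset[OF dom] by blast
  qed
  have WJ: "?W \<subseteq> weyl_group \<alpha> \<alpha>c J" unfolding weyl_group_words by blast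
  have sub: "map_prod id w ` face_bundle K F \<subseteq> face_bundle K F" if "w \<in> ?W" for w
    using translated_face_bundle_subset_iff[OF F s, of w K K F] weyl_group_levi_max_stabilizes_face[OF dom that] WJ that by blast
  show "?W \<subseteq> ?stab"
  proof
    fix w assume w: "w \<in> ?W"
    obtain v where v: "v \<in> ?W" "\<And>x. w (v x) = x" using weyl_group_inverse[OF w] by blast
    have "face_bundle K F \<subseteq> map_prod id w ` face_bundle K F"
    proof
      fix p assume "p \<in> face_bundle K F"
      then have "map_prod id v p \<in> face_bundle K F" using sub[OF v(1)] by blast
      moreover have "map_prod id w (map_prod id v p) = p" using v(2) by (cases p) simp
      ultimately show "p \<in> map_prod id w ` face_bundle K F" by force
    qed
    then show "w \<in> ?stab" using w WJ sub[OF w] by blast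
  qed
qed

end

theorem proposition7p14:
  fixes sc :: "complex \<Rightarrow> 'g::ab_group_add \<Rightarrow> 'g" and bracket :: "'g \<Rightarrow> 'g \<Rightarrow> 'g"
    and A :: "int^'i^'i" and \<alpha> \<alpha>c :: "'i \<Rightarrow> complex^'d"
    and \<iota> :: "complex^'d \<Rightarrow> 'g" and e f :: "'i \<Rightarrow> 'g"
    and \<omega> :: "'i \<Rightarrow> complex^'d \<Rightarrow> real"
    and J J' J'' :: "'i set"
    and S F' F'' :: "'s::euclidean_space set" and \<P> :: "('s \<times> (complex^'d)) set"
    and lam :: "'s \<Rightarrow> complex^'d" and s :: 's
  assumes "kac_moody_algebra sc bracket A \<alpha> \<alpha>c \<iota> e f"
    and "fund_coweights \<alpha> \<omega>"
    and "convex S"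
    and "weyl_family sc bracket \<iota> e f J S \<P>"
    and "\<And>u. u \<in> S \<Longrightarrow> lam u \<in> dom_chamber \<alpha>c J \<and> \<P> `` {u} = weyl_P \<alpha> \<alpha>c (lam u) J"
    and "F' face_of S" and "F' \<noteq> {}"
    and "F'' face_of S" and "F'' \<noteq> {}"
    and "s \<in> rel_interior F'"
  shows "
    (wt_levi_face \<alpha> \<alpha>c \<omega> J lam J' F' \<subseteq> wt_levi_face \<alpha> \<alpha>c \<omega> J lam J'' F'' \<longleftrightarrow>
       F' \<subseteq> F'' \<and> levi_min A \<alpha>c J (lam s) J' \<subseteq> J'') \<and>
    (wt_levi_face \<alpha> \<alpha>c \<omega> J lam J' F' = wt_levi_face \<alpha> \<alpha>c \<omega> J lam J'' F'' \<longleftrightarrow>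
       F' = F'' \<and> levi_min A \<alpha>c J (lam s) J' \<subseteq> J'' \<and> J'' \<subseteq> levi_max A \<alpha>c J (lam s) J') \<and>
    (\<forall>w\<in>weyl_group \<alpha> \<alpha>c J.
       map_prod id w ` wt_levi_face \<alpha> \<alpha>c \<omega> J lam J' F' \<subseteq> wt_levi_face \<alpha> \<alpha>c \<omega> J lam J'' F'' \<longleftrightarrow>
       F' \<subseteq> F'' \<and>
       w ` wt_levi \<omega> J' (weyl_P \<alpha> \<alpha>c (lam s) J) \<subseteq> wt_levi \<omega> J'' (weyl_P \<alpha> \<alpha>c (lam s) J)) \<and>
    {w \<in> weyl_group \<alpha> \<alpha>c J.
       map_prod id w ` wt_levi_face \<alpha> \<alpha>c \<omega> J lam J' F' = wt_levi_face \<alpha> \<alpha>c \<omega> J lam J' F'} =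
    weyl_group \<alpha> \<alpha>c (levi_max A \<alpha>c J (lam s) J' \<inter> J)"
proof -
  interpret kac_moody_algebra sc bracket A \<alpha> \<alpha>c \<iota> e f by fact
  interpret polyhedron_family A \<alpha> \<alpha>c \<omega> J S lam
  proof
    show "gcm A" by (rule gcm)
    show "scalar_product (\<alpha>c i) (\<alpha> j) = of_int (A $ i $ j)" for i j
      using realization by (auto simp: realization_def)
    show "fund_coweights \<alpha> \<omega>" by fact
    show "lam u \<in> dom_chamber \<alpha>c J" if "u \<in> S" for u using assms(5)[OF that] by blast
    fix u v :: 's and t :: real
    assume uv: "u \<in> S" "v \<in> S" and t: "0 \<le> t" "t \<le> 1"
    have inS: "t *\<^sub>R u + (1 - t) *\<^sub>R v \<in> S"
      using \<open>convex S\<close> uv t by (auto intro: convexD)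
    have fiber: "weyl_P \<alpha> \<alpha>c (lam x) J = \<P> `` {x}" if "x \<in> S" for x
      using assms(5)[OF that] by simp
    show "t *\<^sub>R u + (1 - t) *\<^sub>R v \<in> S \<and>
      {t *\<^sub>R x + (1 - t) *\<^sub>R y | x y. x \<in> weyl_P \<alpha> \<alpha>c (lam u) J \<and> y \<in> weyl_P \<alpha> \<alpha>c (lam v) J} =
      weyl_P \<alpha> \<alpha>c (lam (t *\<^sub>R u + (1 - t) *\<^sub>R v)) J"
      using assms(4) uv t inS unfolding weyl_family_def fiber[OF uv(1)] fiber[OF uv(2)] fiber[OF inS]
      by blast
  qed
  have F: "F' \<subseteq> S" "convex F'" and F'': "F'' \<subseteq> S"
    using assms(6,8) by (auto intro: face_of_imp_convex dest: face_of_imp_subset)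
  note s = \<open>s \<in> rel_interior F'\<close>
  show ?thesis
    using face_bundle_subset_iff[OF F s] face_bundle_eq_iff[OF F F'' s]
      translated_face_bundle_subset_iff[OF F s] face_bundle_stabilizer[OF F s]
    by (intro conjI ballI)
qed

end
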